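(* Let $d,k \in \mathbb{N}$ and let $G$ be a $d$-degenerate graph on $n$ vertices. Then the $k$-reconfiguration graph $\mathcal{G}(G,k)$ has diameter at most: \begin{itemize} \item $C n^2$ if $k \geq \frac{3}{2}(d+1)$, where $C$ is a constant independent of $k$ and $d$; \item $C_\varepsilon n^{\lceil 1/\varepsilon \rceil}$ if $k \geq (1+\varepsilon)(d+2)$ and $0<\varepsilon<1$, where $C_\varepsilon$ is a constant independent of $k$ and $d$; \item $(Cn)^{d+1}$ for any $d$ and any $k \geq d+2$, where $C$ is a constant independent of $k$ and $d$. \end{itemize}
   Context: A graph $G$ is $d$-degenerate if every subgraph of $G$ has a vertex of degree at most $d$. A (proper) $k$-colouring of $G$ is a map $f:V(G)\to\{1,\dots,k\}$ with $f(x)\neq f(y)$ for every edge $xy$. The $k$-reconfiguration graph $\mathcal{G}(G,k)$ has as vertices the proper $k$-colourings of $G$, two colourings being adjacent if they differ on exactly one vertex. Its diameter is taken to be $+\infty$ if it is disconnected. *)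

theory Defs
  imports "Graph_Theory.Graph_Theory" "HOL-Library.FuncSet" "HOL-Library.Extended_Real"
begin

text \<open>
  A finite simple graph is a \<^const>\<open>pair_graph\<close>: each undirected edge \<open>xy\<close> is represented by the two
  arcs \<open>(x, y)\<close> and \<open>(y, x)\<close>, so the degree of a vertex is its \<^const>\<open>out_degree\<close>. The library's
  \<^const>\<open>subgraph\<close> also admits asymmetric sub-digraphs, hence the extra \<^const>\<open>pair_graph\<close> condition
  below. The null subgraph is excluded, as it has no vertex at all.
\<close>

definition degenerate :: "nat \<Rightarrow> 'a pair_pre_digraph \<Rightarrow> bool" where
  "degenerate d G \<longleftrightarrow>
    (\<forall>H :: 'a pair_pre_digraph.
       pair_graph H \<and> subgraph (with_proj H) (with_proj G) \<and> pverts H \<noteq> {} \<longrightarrow>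
         (\<exists>v \<in> pverts H. out_degree (with_proj H) v \<le> d))"

text \<open>
  Colourings are extensional functions, so that two colourings agreeing on all vertices of the graph
  are equal.
\<close>

definition proper_colourings :: "'a pair_pre_digraph \<Rightarrow> nat \<Rightarrow> ('a \<Rightarrow> nat) set" where
  "proper_colourings G k =
    {f \<in> pverts G \<rightarrow>\<^sub>E {1..k}. \<forall>(x, y) \<in> parcs G. f x \<noteq> f y}"

definition reconfiguration_graph ::
    "'a pair_pre_digraph \<Rightarrow> nat \<Rightarrow> ('a \<Rightarrow> nat) pair_pre_digraph" where
  "reconfiguration_graph G k =
    \<lparr>pverts = proper_colourings G k,
     parcs = {(f, g). f \<in> proper_colourings G k \<and> g \<in> proper_colourings G k \<and>
                      (\<exists>!v. v \<in> pverts G \<and> f v \<noteq> g v)}\<rparr>"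

text \<open>
  With unit weights, \<open>\<mu>\<close> is the length of a shortest walk, and \<open>\<infinity>\<close> if there is none.
\<close>

definition graph_diameter :: "('a, 'b) pre_digraph \<Rightarrow> ereal" where
  "graph_diameter G = (SUP u\<in>verts G. SUP v\<in>verts G. wf_digraph.\<mu> G (\<lambda>_. 1) u v)"

lemma pair_wf_reconfiguration_graph: "pair_wf_digraph (reconfiguration_graph G k)"
  by unfold_locales (auto simp: reconfiguration_graph_def)

lemma graph_diameter_disconnected:
  assumes "wf_digraph G" "u \<in> verts G" "v \<in> verts G" "\<not> u \<rightarrow>\<^sup>*\<^bsub>G\<^esub> v"
  shows "graph_diameter G = \<infinity>"
proof -
  have "wf_digraph.\<mu> G (\<lambda>_. 1) u v = \<infinity>"
    using assms by (intro wf_digraph.shortest_path_inf)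
  moreover have "wf_digraph.\<mu> G (\<lambda>_. 1) u v \<le> graph_diameter G"
    unfolding graph_diameter_def using assms(2,3) by (meson SUP_upper SUP_upper2)
  ultimately show ?thesis by simp
qed

end

theory Submission
  imports Defs
begin

text \<open>
  Order the vertices so that each has at most \<open>d\<close> earlier neighbours. More generally let every
  vertex \<open>v\<close> have a list of at least \<open>d\<^sup>-(v) + 1 + a\<close> colours, where \<open>d\<^sup>-(v)\<close> counts the earlier
  neighbours, out of \<open>(p + 1) a\<close> colours in total; the claim is a diameter of order
  \<open>a n (n / a)\<^bsup>p-1\<^esup>\<close>, with \<open>a = k - d - 1\<close> for the theorem.

  If \<open>p = 1\<close>, all \<open>d\<^sup>-(v)\<close> are below \<open>a\<close>, and looking ahead over the next \<open>a\<close> moves of its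
  neighbours lets each vertex move at most \<open>a\<close> times.

  For the induction call a set \<open>A\<close> of \<open>a\<close> colours full on a final segment of the order if each of its
  vertices is coloured from \<open>A\<close> or sees all its colours in \<open>A\<close> on earlier neighbours. The vertices of
  the segment not coloured from \<open>A\<close> then form an instance with \<open>p a\<close> colours, so they can be freed
  from any disjoint set \<open>B\<close> of \<open>a\<close> colours, after which \<open>B\<close> can be made full greedily. The \<open>a\<close> vertices
  preceding the segment avoid some set of \<open>a\<close> colours, which can thus be made full on the segment
  extended by them. After about \<open>n / a\<close> such extensions the segment is the whole graph, and from
  there a fixed colouring avoiding \<open>A\<close> is within reach.
\<close>

section \<open>List colourings and recolouring sequences\<close>

primrec apply_moves :: "('v \<Rightarrow> 'c) \<Rightarrow> ('v \<times> 'c) list \<Rightarrow> 'v \<Rightarrow> 'c" where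
  "apply_moves f [] = f"
| "apply_moves f (m # ms) = apply_moves (f(fst m := snd m)) ms"

lemma apply_moves_append: "apply_moves f (ms @ ms') = apply_moves (apply_moves f ms) ms'"
  by (induction ms arbitrary: f) auto

abbreviation moves_in :: "'v set \<Rightarrow> ('v \<times> 'c) list \<Rightarrow> ('v \<times> 'c) list" where
  "moves_in N ms \<equiv> filter (\<lambda>m. fst m \<in> N) ms"

lemma length_moves_in_eq_sum:
  "finite N \<Longrightarrow> length (moves_in N ms) = (\<Sum>u\<in>N. length (moves_in {u} ms))"
proof (induction ms)
  case (Cons m ms)
  have "(\<Sum>u\<in>N. length (moves_in {u} (m # ms)))
      = (\<Sum>u\<in>N. (if u = fst m then 1 else 0) + length (moves_in {u} ms))"
    by (intro sum.cong) auto
  also have "\<dots> = (if fst m \<in> N then 1 else 0) + length (moves_in N ms)"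
    using Cons by (simp add: sum.distrib)
  finally show ?case by simp
qed simp

text \<open>The maximum of what is left is moved into \<open>T\<close>, \<open>b\<close> times. Once
  \<open>M\<close> is exhausted \<open>T\<close> stays put, and truncated subtraction keeps the
  bound on \<open>M - T\<close> correct. Such sets are the blocks by which a final segment
  grows.\<close>

lemma exists_top_segment:
  fixes M :: "'v::linorder set"
  assumes "finite M"
  shows "\<exists>T \<subseteq> M. card T \<le> b \<and> card (M - T) \<le> card M - b \<and> (\<forall>x \<in> T. \<forall>y \<in> M - T. y < x)"
proof (induction b)
  case 0
  show ?case by (intro exI[of _ "{}"]) auto
next
  case (Suc b)
  then obtain T where T: "T \<subseteq> M" "card T \<le> b" "card (M - T) \<le> card M - b"
    "\<forall>x \<in> T. \<forall>y \<in> M - T. y < x" by blast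
  show ?case
  proof (cases "M - T = {}")
    case True
    with T show ?thesis by (intro exI[of _ T]) auto
  next
    case False
    define m where "m = Max (M - T)"
    have m: "m \<in> M - T" "\<And>y. y \<in> M - T \<Longrightarrow> y \<le> m"
      using False assms Max_in[of "M - T"] by (auto simp: m_def)
    have "M - insert m T = (M - T) - {m}" by auto
    then have "card (M - insert m T) \<le> card M - Suc b"
      using m(1) assms T(3) by (simp add: card_Diff_singleton)
    moreover have "card (insert m T) \<le> Suc b"
      using T(1,2) assms m(1) finite_subset by (metis Diff_iff Suc_le_mono card_insert_disjoint)
    moreover have "\<forall>x \<in> insert m T. \<forall>y \<in> M - insert m T. y < x"
      using T(4) m(2) by force
    ultimately show ?thesis using T(1) m(1) by (intro exI[of _ "insert m T"]) auto
  qed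
qed

lemma exists_not_in_small:
  assumes "finite B" "card B < card A"
  shows "\<exists>x \<in> A. x \<notin> B"
  using assms by (meson card_mono not_le subsetI)

locale adjacency =
  fixes E :: "'v::linorder \<Rightarrow> 'v \<Rightarrow> bool"
  assumes sym: "E u v \<Longrightarrow> E v u"
    and irrefl: "\<not> E v v"
begin

definition list_colouring :: "'v set \<Rightarrow> ('v \<Rightarrow> 'c set) \<Rightarrow> ('v \<Rightarrow> 'c) \<Rightarrow> bool" where
  "list_colouring U L f \<longleftrightarrow> (\<forall>v\<in>U. f v \<in> L v) \<and> (\<forall>u\<in>U. \<forall>v\<in>U. E u v \<longrightarrow> f u \<noteq> f v)"

definition back_nbrs :: "'v set \<Rightarrow> 'v \<Rightarrow> 'v set" where
  "back_nbrs U v = {u\<in>U. u < v \<and> E u v}"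

definition feasible :: "'v set \<Rightarrow> ('v \<Rightarrow> 'c set) \<Rightarrow> nat \<Rightarrow> bool" where
  "feasible U L a \<longleftrightarrow> (\<forall>v\<in>U. finite (L v) \<and> card (back_nbrs U v) + 1 + a \<le> card (L v))"

text \<open>Only the colourings after each move are checked, not the initial one, so
  \<open>list_colouring U L f\<close> is assumed separately where it matters. A move may repeat the
  colour already present.\<close>

primrec valid_moves :: "'v set \<Rightarrow> ('v \<Rightarrow> 'c set) \<Rightarrow> ('v \<Rightarrow> 'c) \<Rightarrow> ('v \<times> 'c) list \<Rightarrow> bool" where
  "valid_moves U L f [] \<longleftrightarrow> True"
| "valid_moves U L f (m # ms) \<longleftrightarrow> fst m \<in> U \<and>
     list_colouring U L (f(fst m := snd m)) \<and> valid_moves U L (f(fst m := snd m)) ms"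

definition reach :: "'v set \<Rightarrow> ('v \<Rightarrow> 'c set) \<Rightarrow> ('v \<Rightarrow> 'c) \<Rightarrow> ('v \<Rightarrow> 'c) \<Rightarrow> nat \<Rightarrow> bool" where
  "reach U L f g m \<longleftrightarrow> (\<exists>ms. valid_moves U L f ms \<and> apply_moves f ms = g \<and> length ms \<le> m)"

lemma list_colouring_cong:
  "(\<And>v. v \<in> U \<Longrightarrow> f v = g v) \<Longrightarrow> list_colouring U L f = list_colouring U L g"
  by (auto simp: list_colouring_def)

lemma list_colouring_subset: "list_colouring U L f \<Longrightarrow> W \<subseteq> U \<Longrightarrow> list_colouring W L f"
  by (auto simp: list_colouring_def)

lemma list_colouring_upd:
  assumes "list_colouring U L f" "c \<in> L v" "\<And>u. u \<in> U \<Longrightarrow> E u v \<Longrightarrow> f u \<noteq> c"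
  shows "list_colouring U L (f(v := c))"
  unfolding list_colouring_def
proof (intro conjI ballI impI)
  show "(f(v := c)) u \<in> L u" if "u \<in> U" for u
    using assms(1,2) that by (auto simp: list_colouring_def)
  show "(f(v := c)) u \<noteq> (f(v := c)) w" if "u \<in> U" "w \<in> U" "E u w" for u w
    using that assms(1) assms(3)[of u] assms(3)[of w] sym[OF that(3)] irrefl[of v]
    by (auto simp: list_colouring_def)
qed

lemma finite_back_nbrs: "finite U \<Longrightarrow> finite (back_nbrs U v)"
  by (simp add: back_nbrs_def)

lemma valid_moves_append:
  "valid_moves U L f (ms @ ms') \<longleftrightarrow> valid_moves U L f ms \<and> valid_moves U L (apply_moves f ms) ms'"
  by (induction ms arbitrary: f) auto

lemma valid_moves_vertices: "valid_moves U L f ms \<Longrightarrow> fst ` set ms \<subseteq> U"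
  by (induction ms arbitrary: f) auto

text \<open>Neither the moves nor the checks look outside \<open>U\<close>. This lets the moves of a
  new vertex be interleaved with a given sequence.\<close>

lemma valid_moves_upd_outside:
  assumes "x \<notin> U"
  shows "valid_moves U L (f(x := c)) ms = valid_moves U L f ms"
proof (induction ms arbitrary: f)
  case (Cons m ms)
  obtain v d where m: "m = (v, d)" by (cases m)
  show ?case
  proof (cases "v = x")
    case True
    with assms show ?thesis by (simp add: m)
  next
    case False
    define f' where "f' = f(v := d)"
    have "f(x := c, v := d) = f'(x := c)" using False by (simp add: f'_def fun_upd_twist)
    moreover have "list_colouring U L (f'(x := c)) = list_colouring U L f'"
      using assms by (intro list_colouring_cong) auto
    ultimately show ?thesis using Cons.IH[of f'] by (simp del: fun_upd_apply add: m f'_def[symmetric])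
  qed
qed simp

lemma apply_moves_upd_outside:
  "valid_moves U L f ms \<Longrightarrow> x \<notin> U \<Longrightarrow> apply_moves (f(x := c)) ms = (apply_moves f ms)(x := c)"
proof (induction ms arbitrary: f)
  case (Cons m ms)
  obtain v d where m: "m = (v, d)" by (cases m)
  define f' where "f' = f(v := d)"
  have v: "v \<noteq> x" and f': "valid_moves U L f' ms" using Cons.prems by (auto simp: m f'_def)
  have "f(x := c, v := d) = f'(x := c)" using v by (simp add: f'_def fun_upd_twist)
  then show ?case using Cons.IH[OF f' Cons.prems(2)]
    by (simp del: fun_upd_apply add: m f'_def[symmetric])
qed simp

lemma apply_moves_outside: "valid_moves U L f ms \<Longrightarrow> x \<notin> U \<Longrightarrow> apply_moves f ms x = f x"
  by (induction ms arbitrary: f) auto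

lemma apply_moves_list_colouring:
  "list_colouring U L f \<Longrightarrow> valid_moves U L f ms \<Longrightarrow> list_colouring U L (apply_moves f ms)"
  by (induction ms arbitrary: f) auto

text \<open>Moves inside \<open>W\<close> leave the rest of \<open>U\<close> fixed, so once the
  colours of neighbours outside \<open>W\<close> are struck from the lists, only conflicts within
  \<open>W\<close> remain. Solving a smaller instance thereby recolours the whole graph.\<close>

lemma valid_moves_extend:
  assumes "W \<subseteq> U" "list_colouring U L f"
    and "\<And>w. w \<in> W \<Longrightarrow> L' w \<subseteq> {c \<in> L w. \<forall>u \<in> U - W. E u w \<longrightarrow> f u \<noteq> c}"
    and "valid_moves W L' f ms"
  shows "valid_moves U L f ms"
  using assms(2-)
proof (induction ms arbitrary: f)
  case (Cons m ms)
  obtain v d where m: "m = (v, d)" by (cases m)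
  define f' where "f' = f(v := d)"
  from Cons.prems have v: "v \<in> W" and W: "list_colouring W L' f'" and ms: "valid_moves W L' f' ms"
    by (auto simp: m f'_def)
  have d: "d \<in> L' v" using v W by (auto simp: list_colouring_def f'_def)
  have "f u \<noteq> d" if "u \<in> U" "E u v" for u
  proof (cases "u \<in> W")
    case True
    with that v W irrefl show ?thesis unfolding list_colouring_def f'_def
      by (metis fun_upd_apply)
  next
    case False
    with that v d Cons.prems(2)[OF v] show ?thesis by auto
  qed
  then have ok: "list_colouring U L f'"
    unfolding f'_def using Cons.prems(1,2) v d by (intro list_colouring_upd) auto
  have "L' w \<subseteq> {c \<in> L w. \<forall>u \<in> U - W. E u w \<longrightarrow> f' u \<noteq> c}" if "w \<in> W" for w
    using Cons.prems(2)[OF that] v by (auto simp: f'_def)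
  then have "valid_moves U L f' ms" using Cons.IH[OF ok _ ms] by blast
  with ok v assms(1) show ?case by (auto simp: m f'_def)
qed simp

lemma reach_refl: "reach U L f f m"
  unfolding reach_def by (intro exI[of _ "[]"]) auto

lemma reach_mono: "reach U L f g m \<Longrightarrow> m \<le> m' \<Longrightarrow> reach U L f g m'"
  unfolding reach_def using order_trans by blast

lemma reach_trans: "reach U L f g m \<Longrightarrow> reach U L g h m' \<Longrightarrow> reach U L f h (m + m')"
proof -
  assume "reach U L f g m" "reach U L g h m'"
  then obtain ms ms' where "valid_moves U L f ms" "apply_moves f ms = g" "length ms \<le> m"
    "valid_moves U L g ms'" "apply_moves g ms' = h" "length ms' \<le> m'"
    unfolding reach_def by blast
  then show ?thesis unfolding reach_def
    by (intro exI[of _ "ms @ ms'"]) (auto simp: valid_moves_append apply_moves_append)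
qed

lemma reach_step: "v \<in> U \<Longrightarrow> list_colouring U L (f(v := c)) \<Longrightarrow> reach U L f (f(v := c)) 1"
  unfolding reach_def by (intro exI[of _ "[(v, c)]"]) auto

lemma reach_outside: "reach U L f g m \<Longrightarrow> x \<notin> U \<Longrightarrow> g x = f x"
  unfolding reach_def using apply_moves_outside by blast

lemma reach_list_colouring: "reach U L f g m \<Longrightarrow> list_colouring U L f \<Longrightarrow> list_colouring U L g"
  unfolding reach_def using apply_moves_list_colouring by blast

text \<open>The moves are undone in reverse order. The reversed sequence ends in \<open>f\<close>,
  so \<open>f\<close> itself must be known to be a colouring.\<close>

lemma reach_sym:
  assumes "reach U L f g m" "list_colouring U L f"
  shows "reach U L g f m"
proof -
  have *: "reach U L (apply_moves f ms) f (length ms)"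
    if "valid_moves U L f ms" "list_colouring U L f" for ms
    using that
  proof (induction ms arbitrary: f)
    case (Cons m ms)
    define f' where "f' = f(fst m := snd m)"
    have undo: "f'(fst m := f (fst m)) = f" by (auto simp: f'_def)
    have "reach U L (apply_moves f' ms) f' (length ms)"
      using Cons.IH[of f'] Cons.prems by (simp add: f'_def[symmetric])
    moreover have "reach U L f' f 1"
      using reach_step[of "fst m" U L f' "f (fst m)"] Cons.prems by (simp add: undo)
    ultimately show ?case using reach_trans f'_def by fastforce
  qed (simp add: reach_refl)
  show ?thesis using assms * unfolding reach_def[of U L f g] by (metis reach_mono)
qed

text \<open>The last assumption makes every mixture of \<open>f\<close> and \<open>g\<close> proper,
  so the vertices of \<open>D\<close> can change in any order, one move each.\<close>

lemma reach_pointwise: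
  assumes "finite D" "D \<subseteq> U" "list_colouring U L f" "list_colouring U L g"
    and "\<And>v. v \<notin> D \<Longrightarrow> f v = g v"
    and "\<And>u v. u \<in> U \<Longrightarrow> v \<in> U \<Longrightarrow> E u v \<Longrightarrow> f u \<noteq> g v"
  shows "reach U L f g (card D)"
  using assms
proof (induction D arbitrary: f rule: finite_induct)
  case empty
  then have "f = g" by auto
  then show ?case by (simp add: reach_refl)
next
  case (insert x D)
  define f' where "f' = f(x := g x)"
  have ok: "list_colouring U L f'"
    unfolding f'_def using insert.prems by (intro list_colouring_upd) (auto simp: list_colouring_def)
  have "reach U L f' g (card D)"
  proof (rule insert.IH)
    show "f' u \<noteq> g v" if "u \<in> U" "v \<in> U" "E u v" for u v
      using that insert.prems(3,5) by (auto simp: f'_def list_colouring_def)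
  next
    show "list_colouring U L f'" by (rule ok)
  qed (use insert.prems in \<open>auto simp: f'_def\<close>)
  moreover have "reach U L f f' 1" unfolding f'_def using insert.prems(1) ok by (intro reach_step) (auto simp: f'_def)
  ultimately have "reach U L f g (1 + card D)" using reach_trans by blast
  then show ?case using insert.hyps by simp
qed

text \<open>Greedy colouring along the order: each list has more colours than there are earlier
  neighbours. Copying \<open>f\<close> outside \<open>U\<close> makes the result comparable with
  \<open>f\<close>.\<close>

lemma exists_list_colouring:
  assumes "finite U" "feasible U L 0"
  shows "\<exists>g. list_colouring U L g \<and> (\<forall>x. x \<notin> U \<longrightarrow> g x = f x)"
  using assms
proof (induction U rule: finite_linorder_max_induct)
  case empty
  show ?case by (auto simp: list_colouring_def)
next
  case (insert v U)
  have "back_nbrs U w = back_nbrs (insert v U) w" if "w \<in> U" for w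
    using insert.hyps that by (auto simp: back_nbrs_def)
  then have "feasible U L 0" using insert.prems by (auto simp: feasible_def)
  then obtain g where g: "list_colouring U L g" "\<forall>x. x \<notin> U \<longrightarrow> g x = f x"
    using insert.IH by blast
  have nb: "back_nbrs (insert v U) v = {u\<in>U. E u v}"
    using insert.hyps irrefl by (auto simp: back_nbrs_def)
  have fin: "finite {u\<in>U. E u v}" using insert.hyps by simp
  have "card (g ` {u\<in>U. E u v}) \<le> card {u\<in>U. E u v}" using fin by (rule card_image_le)
  also have "\<dots> < card (L v)" using insert.prems nb by (auto simp: feasible_def)
  finally obtain c where c: "c \<in> L v" "c \<notin> g ` {u\<in>U. E u v}"
    using exists_not_in_small[of "g ` {u\<in>U. E u v}" "L v"] fin by auto
  have "v \<notin> U" using insert.hyps by auto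
  then have "list_colouring (insert v U) L (g(v := c))"
    using g(1) c sym irrefl unfolding list_colouring_def by (auto split: if_splits)
  moreover have "\<forall>x. x \<notin> insert v U \<longrightarrow> (g(v := c)) x = f x" using g(2) by simp
  ultimately show ?case by blast
qed

section \<open>Few colours: every vertex is recoloured at most \<open>a\<close> times\<close>

text \<open>
  The new vertex \<open>v\<close> only moves when a neighbour is about to take its colour, and then to a colour
  that none of the next \<open>a\<close> moves of its neighbours uses. The number \<open>r\<close> counts the upcoming moves
  against which the present colour of \<open>v\<close> is known to be safe.
\<close>

lemma extend_moves_by_vertex:
  assumes "finite U" "v \<notin> U" "finite (L v)" "a > 0"
    and "card {u\<in>U. E u v} + 1 + a \<le> card (L v)"
    and "list_colouring (insert v U) L f" "valid_moves U L f ms"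
    and "r \<le> length (moves_in {u\<in>U. E u v} ms)"
    and "f v \<notin> snd ` set (take r (moves_in {u\<in>U. E u v} ms))"
  shows "\<exists>ms'. valid_moves (insert v U) L f ms'
    \<and> (\<forall>x. x \<noteq> v \<longrightarrow> apply_moves f ms' x = apply_moves f ms x)
    \<and> (\<forall>u \<in> U. length (moves_in {u} ms') = length (moves_in {u} ms))
    \<and> length (moves_in {v} ms') * a + r + 1 \<le> length (moves_in {u\<in>U. E u v} ms) + a"
  using assms(6-)
proof (induction ms arbitrary: f r)
  \<comment> \<open>The last conjunct says that \<open>v\<close> moves at most
    \<open>(t - r) / a\<close> times, rounded up, where \<open>t\<close> counts the moves of its
    neighbours.\<close>
  case Nil
  then show ?case using assms(4) by (intro exI[of _ "[]"]) auto
next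
  case (Cons m ms)
  let ?N = "{u\<in>U. E u v}"
  let ?V = "insert v U"
  obtain u c where m: "m = (u, c)" by (cases m)
  let ?f = "f(u := c)"
  have u: "u \<in> U" "u \<noteq> v" and okU: "list_colouring U L ?f" and ms: "valid_moves U L ?f ms"
    using Cons.prems(2) assms(2) by (auto simp: m)
  \<comment> \<open>On a colouring that differs from \<open>f\<close> only at \<open>v\<close>, the
    move \<open>m\<close> can fail only by giving a neighbour of \<open>v\<close> the colour of
    \<open>v\<close>.\<close>
  have okV: "list_colouring ?V L (h(u := c))"
    if h: "list_colouring ?V L h" and hf: "\<And>x. x \<noteq> v \<Longrightarrow> h x = f x" and "u \<in> ?N \<longrightarrow> c \<noteq> h v" for h
  proof (rule list_colouring_upd[OF h])
    show "c \<in> L u" using okU u by (auto simp: list_colouring_def)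
    fix w assume w: "w \<in> ?V" "E w u"
    show "h w \<noteq> c"
    proof (cases "w = v")
      case True
      with w that u sym show ?thesis by auto
    next
      case False
      have "w \<noteq> u" using irrefl w by auto
      moreover have "?f w \<noteq> ?f u" using okU w False u unfolding list_colouring_def by blast
      ultimately show ?thesis using hf[OF False] by simp
    qed
  qed
  show ?case
  proof (cases "u \<in> ?N \<and> c = f v")
    case False
    \<comment> \<open>A neighbour's move uses up one unit of the guarantee \<open>r\<close>; other
      moves leave it alone.\<close>
    define r' where "r' = (if u \<in> ?N then r - 1 else r)"
    have ok: "list_colouring ?V L ?f" using okV[OF Cons.prems(1)] False by auto
    have r': "r' \<le> length (moves_in ?N ms)" "?f v \<notin> snd ` set (take r' (moves_in ?N ms))"
      using Cons.prems(3,4) u by (cases r; auto simp: r'_def m)+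
    obtain ms' where ms': "valid_moves ?V L ?f ms'"
      "\<forall>x. x \<noteq> v \<longrightarrow> apply_moves ?f ms' x = apply_moves ?f ms x"
      "\<forall>u \<in> U. length (moves_in {u} ms') = length (moves_in {u} ms)"
      "length (moves_in {v} ms') * a + r' + 1 \<le> length (moves_in ?N ms) + a"
      using Cons.IH[OF ok ms r'] by blast
    have "length (moves_in {v} (m # ms')) * a + r + 1 \<le> length (moves_in ?N (m # ms)) + a"
      using ms'(4) u by (auto simp: m r'_def)
    then show ?thesis using ms' ok u m by (intro exI[of _ "m # ms'"]) auto
  next
    case True
    then have r0: "r = 0"
      using Cons.prems(4) by (cases r) (auto simp: m)
    define Nm where "Nm = moves_in ?N ms"
    \<comment> \<open>\<open>B\<close> holds the present colours of the neighbours, the colour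
      \<open>c\<close> of the imminent move and those of the next \<open>a - 1\<close> neighbour
      moves: at most \<open>card ?N + a\<close> in all, fewer than the list of \<open>v\<close>
      contains.\<close>
    define B where "B = f ` ?N \<union> insert c (snd ` set (take (a - 1) Nm))"
    have "card (snd ` set (take (a - 1) Nm)) \<le> a - 1"
      by (rule order_trans[OF card_image_le]) (auto intro: order_trans[OF card_length])
    then have "card (insert c (snd ` set (take (a - 1) Nm))) \<le> a"
      using assms(4) by (intro order_trans[OF card_insert_le_m1]) auto
    moreover have "card (f ` ?N) \<le> card ?N" using assms(1) by (intro card_image_le) auto
    ultimately have "card B < card (L v)"
      using assms(5) card_Un_le[of "f ` ?N" "insert c (snd ` set (take (a - 1) Nm))"]
      by (simp add: B_def)
    moreover have "finite B" using assms(1) by (simp add: B_def)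
    ultimately obtain c' where c': "c' \<in> L v" "c' \<notin> B"
      using exists_not_in_small by blast
    let ?h = "f(v := c')"
    let ?g = "?h(u := c)"
    have okh: "list_colouring ?V L ?h"
      using c' Cons.prems(1) irrefl by (intro list_colouring_upd) (auto simp: B_def)
    have okg: "list_colouring ?V L ?g"
      by (rule okV[OF okh]) (use c' in \<open>auto simp: B_def\<close>)
    have geq: "?g = ?f(v := c')" using u by (simp add: fun_upd_twist)
    have msg: "valid_moves U L ?g ms"
      unfolding geq using ms assms(2) by (simp add: valid_moves_upd_outside)
    \<comment> \<open>The new colour is safe against \<open>a\<close> moves including
      \<open>m\<close>, which leaves \<open>a - 1\<close> for the tail, or all of the tail if it is
      shorter.\<close>
    define r' where "r' = min (a - 1) (length Nm)"
    have r': "r' \<le> length (moves_in ?N ms)" "?g v \<notin> snd ` set (take r' (moves_in ?N ms))"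
      using c' u unfolding Nm_def[symmetric] by (auto simp: r'_def B_def min_def)
    obtain ms' where ms': "valid_moves ?V L ?g ms'"
      "\<forall>x. x \<noteq> v \<longrightarrow> apply_moves ?g ms' x = apply_moves ?g ms x"
      "\<forall>u \<in> U. length (moves_in {u} ms') = length (moves_in {u} ms)"
      "length (moves_in {v} ms') * a + r' + 1 \<le> length (moves_in ?N ms) + a"
      using Cons.IH[OF okg msg r'] by blast
    have out: "apply_moves ?g ms = (apply_moves ?f ms)(v := c')"
      unfolding geq using ms assms(2) by (simp add: apply_moves_upd_outside)
    \<comment> \<open>The new move of \<open>v\<close> costs \<open>a\<close>, paid by the guarantee
      \<open>a - 1\<close> and by \<open>m\<close> itself. If fewer than \<open>a - 1\<close>
      neighbour moves are left, the induction hypothesis shows that \<open>v\<close> never moves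
      again.\<close>
    have "length (moves_in {v} ms') * a + a + 1 \<le> length Nm + 1 + a"
    proof (cases "a - 1 \<le> length Nm")
      case True
      then show ?thesis using ms'(4) unfolding Nm_def[symmetric] by (simp add: r'_def)
    next
      case False
      then have "length (moves_in {v} ms') * a < a"
        using ms'(4) unfolding Nm_def[symmetric] r'_def by linarith
      then have "length (moves_in {v} ms') < 1" by (metis mult_1 mult_less_cancel2)
      then show ?thesis by simp
    qed
    then have "length (moves_in {v} ((v, c') # m # ms')) * a + r + 1 \<le> length (moves_in ?N (m # ms)) + a"
      using True u r0 by (simp add: m Nm_def)
    then show ?thesis
      using ms' okh okg out u m assms(2) by (intro exI[of _ "(v, c') # m # ms'"]) auto
  qed
qed

text \<open>Vertices are added in increasing order. The fewer than \<open>a\<close> earlier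
  neighbours of \<open>v\<close> make at most \<open>(a - 1) * a\<close> moves, forcing at most
  \<open>a - 1\<close> moves of \<open>v\<close>; one final move brings \<open>v\<close> to its
  target colour.\<close>

lemma exists_moves_few_per_vertex:
  assumes "finite U" "feasible U L a" "\<And>v. v \<in> U \<Longrightarrow> card (back_nbrs U v) < a"
    and "list_colouring U L f" "list_colouring U L g" "\<And>x. x \<notin> U \<Longrightarrow> f x = g x"
  shows "\<exists>ms. valid_moves U L f ms \<and> apply_moves f ms = g \<and> (\<forall>u\<in>U. length (moves_in {u} ms) \<le> a)"
  using assms
proof (induction U arbitrary: g rule: finite_linorder_max_induct)
  case empty
  then have "f = g" by auto
  then show ?case by (intro exI[of _ "[]"]) auto
next
  case (insert v U)
  let ?N = "{u\<in>U. E u v}"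
  have nb: "back_nbrs U w = back_nbrs (insert v U) w" if "w \<in> U" for w
    using insert.hyps that by (auto simp: back_nbrs_def)
  have nbv: "back_nbrs (insert v U) v = ?N"
    using insert.hyps irrefl by (auto simp: back_nbrs_def)
  have v: "v \<notin> U" using insert.hyps by auto
  have a: "card ?N < a" using insert.prems(2)[of v] nbv by simp
  \<comment> \<open>The target keeps \<open>f v\<close> at \<open>v\<close>, since the induction
    hypothesis for \<open>U\<close> requires both colourings to agree outside
    \<open>U\<close>.\<close>
  obtain ms where ms: "valid_moves U L f ms" "apply_moves f ms = g(v := f v)"
    "\<forall>u\<in>U. length (moves_in {u} ms) \<le> a"
  proof -
    have "feasible U L a" using insert.prems(1) nb by (auto simp: feasible_def)
    moreover have "card (back_nbrs U w) < a" if "w \<in> U" for w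
      using insert.prems(2)[of w] nb that by simp
    moreover have "list_colouring U L f" "list_colouring U L g"
      using insert.prems by (auto intro: list_colouring_subset)
    moreover have "list_colouring U L (g(v := f v)) = list_colouring U L g"
      using v by (intro list_colouring_cong) auto
    moreover define g' where "g' = g(v := f v)"
    moreover have "\<And>x. x \<notin> U \<Longrightarrow> f x = g' x" using insert.prems(5) by (simp add: g'_def)
    ultimately show ?thesis
      using insert.IH[of g'] that by (simp del: fun_upd_apply) blast
  qed
  have "length (moves_in ?N ms) = (\<Sum>u\<in>?N. length (moves_in {u} ms))"
    using insert.hyps by (intro length_moves_in_eq_sum) auto
  also have "\<dots> \<le> card ?N * a" using ms(3) sum_bounded_above[of ?N "\<lambda>u. length (moves_in {u} ms)" a] by auto
  also have "\<dots> \<le> (a - 1) * a" using a by (intro mult_right_mono) auto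
  finally have t: "length (moves_in ?N ms) \<le> (a - 1) * a" .
  obtain ms' where ms': "valid_moves (insert v U) L f ms'"
    "\<forall>x. x \<noteq> v \<longrightarrow> apply_moves f ms' x = apply_moves f ms x"
    "\<forall>u \<in> U. length (moves_in {u} ms') = length (moves_in {u} ms)"
    "length (moves_in {v} ms') * a + 1 \<le> length (moves_in ?N ms) + a"
    using extend_moves_by_vertex[of U v L a f ms 0] insert.hyps insert.prems ms(1) v a nbv
    by (auto simp: feasible_def)
  have "length (moves_in {v} ms') * a < (a - 1) * a + a" using ms'(4) t by linarith
  also have "\<dots> = a * a" using a by (cases a) auto
  finally have cv: "length (moves_in {v} ms') < a" by simp
  have fin: "(apply_moves f ms')(v := g v) = g"
    using ms'(2) ms(2) by (auto simp: fun_eq_iff)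
  let ?ms = "ms' @ [(v, g v)]"
  have "valid_moves (insert v U) L f ?ms" "apply_moves f ?ms = g"
    using ms'(1) fin insert.prems(4) by (auto simp: valid_moves_append apply_moves_append)
  moreover have "\<forall>u\<in>insert v U. length (moves_in {u} ?ms) \<le> a"
    using cv ms'(3) ms(3) v by auto
  ultimately show ?case by blast
qed

lemma reach_small_back_degree:
  assumes "finite U" "feasible U L a" "\<And>v. v \<in> U \<Longrightarrow> card (back_nbrs U v) < a"
    and "list_colouring U L f" "list_colouring U L g" "\<And>x. x \<notin> U \<Longrightarrow> f x = g x"
  shows "reach U L f g (a * card U)"
proof -
  obtain ms where ms: "valid_moves U L f ms" "apply_moves f ms = g"
    "\<forall>u\<in>U. length (moves_in {u} ms) \<le> a"
    using exists_moves_few_per_vertex[OF assms] by blast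
  have "moves_in U ms = ms"
    using valid_moves_vertices[OF ms(1)] by (auto simp: filter_id_conv)
  then have "length ms = (\<Sum>u\<in>U. length (moves_in {u} ms))"
    using length_moves_in_eq_sum[OF assms(1), of ms] by simp
  also have "\<dots> \<le> card U * a" using ms(3) sum_bounded_above[of U "\<lambda>u. length (moves_in {u} ms)" a] by auto
  finally show ?thesis using ms unfolding reach_def by (auto simp: mult.commute)
qed

end

context adjacency
begin

section \<open>Full sets of colours\<close>

definition up_closed :: "'v set \<Rightarrow> 'v set \<Rightarrow> bool" where
  "up_closed U S \<longleftrightarrow> S \<subseteq> U \<and> (\<forall>v\<in>S. \<forall>u\<in>U. v < u \<longrightarrow> u \<in> S)"

definition full :: "'v set \<Rightarrow> ('v \<Rightarrow> 'c set) \<Rightarrow> 'c set \<Rightarrow> 'v set \<Rightarrow> ('v \<Rightarrow> 'c) \<Rightarrow> bool" where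
  "full U L A S f \<longleftrightarrow> (\<forall>v\<in>S. f v \<notin> A \<longrightarrow> A \<inter> L v \<subseteq> f ` back_nbrs U v)"

text \<open>These are the lists for the vertices of \<open>S\<close> not coloured from
  \<open>A\<close> when all others stay fixed. Fixed neighbours in \<open>S\<close> are coloured
  from \<open>A\<close>; those outside a final segment \<open>S\<close> come earlier, and their
  colours are struck out.\<close>

definition residual_lists ::
    "'v set \<Rightarrow> ('v \<Rightarrow> 'c set) \<Rightarrow> 'c set \<Rightarrow> 'v set \<Rightarrow> ('v \<Rightarrow> 'c) \<Rightarrow> 'v \<Rightarrow> 'c set" where
  "residual_lists U L A S f v = L v - A - f ` (back_nbrs U v - S)"

lemma up_closed_self: "up_closed U U" and up_closed_empty: "up_closed U {}"
  by (auto simp: up_closed_def)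

lemma back_nbrs_outside_up_closed:
  assumes "up_closed U S" "v \<in> S" "u \<in> U - S" "E u v"
  shows "u \<in> back_nbrs U v - S"
proof -
  have "\<not> v < u" "u \<noteq> v" using assms by (auto simp: up_closed_def)
  then show ?thesis using assms by (auto simp: back_nbrs_def)
qed

text \<open>
  Deleting the vertices coloured from a full set \<open>A\<close> and the colours of \<open>A\<close> themselves costs each
  remaining vertex no more colours than earlier neighbours, so feasibility survives.
\<close>

lemma feasible_residual_lists:
  assumes "finite U" "feasible U L a" "S \<subseteq> U" "full U L A S f"
  shows "feasible {v\<in>S. f v \<notin> A} (residual_lists U L A S f) a"
  unfolding feasible_def
proof (intro ballI conjI)
  fix v assume v: "v \<in> {v\<in>S. f v \<notin> A}"
  let ?W = "{v\<in>S. f v \<notin> A}"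
  let ?L' = "residual_lists U L A S f"
  have Lv: "finite (L v)" "card (back_nbrs U v) + 1 + a \<le> card (L v)"
    using assms(2,3) v by (auto simp: feasible_def)
  then show "finite (?L' v)" by (simp add: residual_lists_def)
  let ?R = "back_nbrs U v - back_nbrs ?W v"
  have sub: "back_nbrs ?W v \<subseteq> back_nbrs U v" using assms(3) by (auto simp: back_nbrs_def)
  \<comment> \<open>Each lost colour sits on an earlier neighbour outside the residual instance: for
    a colour of \<open>A\<close> by fullness, for any other colour by the definition of the
    lists.\<close>
  have "L v - ?L' v \<subseteq> f ` ?R"
  proof
    fix c assume c: "c \<in> L v - ?L' v"
    show "c \<in> f ` ?R"
    proof (cases "c \<in> A")
      case True
      then have "c \<in> f ` back_nbrs U v" using assms(4) v c by (auto simp: full_def)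
      then obtain u where "u \<in> back_nbrs U v" "c = f u" by auto
      with True show ?thesis by (auto simp: back_nbrs_def)
    next
      case False
      then show ?thesis using c by (auto simp: residual_lists_def back_nbrs_def)
    qed
  qed
  then have "card (L v - ?L' v) \<le> card ?R"
    using finite_back_nbrs[OF assms(1)] by (meson surj_card_le finite_Diff)
  also have "\<dots> = card (back_nbrs U v) - card (back_nbrs ?W v)"
    using sub finite_back_nbrs[OF assms(1)] by (meson card_Diff_subset finite_subset)
  finally have "card (L v - ?L' v) \<le> card (back_nbrs U v) - card (back_nbrs ?W v)" .
  moreover have "card (back_nbrs ?W v) \<le> card (back_nbrs U v)"
    using sub finite_back_nbrs[OF assms(1)] by (intro card_mono)
  moreover have "card (L v) = card (?L' v) + card (L v - ?L' v)"
    using Lv(1) card_Int_Diff[of "L v" "?L' v"]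
    by (simp add: residual_lists_def Int_absorb1 Diff_subset subset_iff Int_commute)
  ultimately show "card (back_nbrs ?W v) + 1 + a \<le> card (?L' v)" using Lv(2) by linarith
qed

text \<open>The slack \<open>a\<close> pays for deleting \<open>a\<close> colours; slack
  \<open>0\<close> still suffices for greedy colouring.\<close>

lemma feasible_diff:
  assumes "feasible U L a" "finite A" "card A \<le> a"
  shows "feasible U (\<lambda>v. L v - A) 0"
  unfolding feasible_def
proof (intro ballI conjI)
  fix v assume v: "v \<in> U"
  then show "finite (L v - A)" using assms(1) by (auto simp: feasible_def)
  have "card (L v) - card A \<le> card (L v - A)" using assms(2) by (rule diff_card_le_card_Diff)
  then show "card (back_nbrs U v) + 1 + 0 \<le> card (L v - A)"
    using assms(1,3) v by (auto simp: feasible_def)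
qed

text \<open>Sweep \<open>S\<close> upwards and give each vertex a colour of \<open>A\<close>
  whenever its earlier neighbours permit. Later neighbours lie in \<open>S\<close> and do not yet
  use \<open>A\<close>, so they never conflict, and a decision once made is not disturbed by the
  rest of the sweep.\<close>

lemma reach_full:
  assumes "finite U" "up_closed U S" "list_colouring U L f"
    and "\<And>v. v \<in> S \<Longrightarrow> f v \<notin> A"
  shows "\<exists>g. reach U L f g (card S) \<and> full U L A S g \<and> (\<forall>v. v \<notin> S \<longrightarrow> g v = f v)"
proof -
  have "finite S" using assms(1,2) finite_subset by (auto simp: up_closed_def)
  from this assms(2-) show ?thesis
  proof (induction "card S" arbitrary: S f)
    case 0
    then have "S = {}" by simp
    then show ?case by (intro exI[of _ f]) (auto simp: reach_refl full_def)
  next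
    case (Suc n)
    define x where "x = Min S"
    have "S \<noteq> {}" using Suc.hyps(2) by auto
    then have x: "x \<in> S" "\<And>v. v \<in> S \<Longrightarrow> x \<le> v" using Suc.prems(1) by (auto simp: x_def)
    have xU: "x \<in> U" using x Suc.prems(2) by (auto simp: up_closed_def)
    let ?S = "S - {x}"
    have up: "up_closed U ?S" using Suc.prems(2) x by (force simp: up_closed_def)
    have cS: "n = card ?S" "finite ?S" using Suc.hyps(2) x(1) Suc.prems(1) by auto
    have nb: "v \<notin> S" if "v \<in> back_nbrs U x" for v using that x by (force simp: back_nbrs_def)
    show ?case
    proof (cases "A \<inter> L x \<subseteq> f ` back_nbrs U x")
      case True
      obtain g where g: "reach U L f g n" "full U L A ?S g" "\<forall>v. v \<notin> ?S \<longrightarrow> g v = f v"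
        using Suc.hyps(1)[OF cS(1) cS(2) up Suc.prems(3)] Suc.prems(4) cS(1) by auto
      \<comment> \<open>As \<open>x\<close> is the minimum of \<open>S\<close>, its earlier
        neighbours lie outside \<open>S\<close> and keep their colours, so \<open>x\<close> stays
        blocked.\<close>
      have gx: "g ` back_nbrs U x = f ` back_nbrs U x" using nb g(3) by (intro image_cong) auto
      have "full U L A S g" unfolding full_def
      proof (intro ballI impI)
        fix v assume v: "v \<in> S" "g v \<notin> A"
        show "A \<inter> L v \<subseteq> g ` back_nbrs U v"
        proof (cases "v = x")
          case True
          with \<open>A \<inter> L x \<subseteq> f ` back_nbrs U x\<close> gx show ?thesis by simp
        next
          case False
          then have "v \<in> ?S" using v by simp
          then show ?thesis using g(2)[unfolded full_def, THEN bspec, THEN mp] v(2) by blast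
        qed
      qed
      moreover have "reach U L f g (card S)" using reach_mono[OF g(1)] Suc.hyps(2) by simp
      moreover have "\<forall>v. v \<notin> S \<longrightarrow> g v = f v" using g(3) by simp
      ultimately show ?thesis by blast
    next
      case False
      then obtain c where c: "c \<in> A" "c \<in> L x" "c \<notin> f ` back_nbrs U x" by auto
      define f' where "f' = f(x := c)"
      have "f u \<noteq> c" if "u \<in> U" "E u x" for u
      proof (cases "u < x")
        case True
        with that c show ?thesis by (auto simp: back_nbrs_def)
      next
        case False
        then have "x < u" using that irrefl by (metis neqE)
        then have "u \<in> S" using Suc.prems(2) x that by (auto simp: up_closed_def)
        then show ?thesis using Suc.prems(4) c by auto
      qed
      then have ok: "list_colouring U L f'"
        unfolding f'_def using Suc.prems(3) c by (intro list_colouring_upd)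
      have free: "\<And>v. v \<in> ?S \<Longrightarrow> f' v \<notin> A" using Suc.prems(4) by (auto simp: f'_def)
      obtain g where g: "reach U L f' g n" "full U L A ?S g" "\<forall>v. v \<notin> ?S \<longrightarrow> g v = f' v"
        using Suc.hyps(1)[OF cS(1) cS(2) up ok free] cS(1) by auto
      have "reach U L f f' 1" using reach_step[OF xU ok[unfolded f'_def]] by (simp only: f'_def)
      then have "reach U L f g (1 + n)" using g(1) reach_trans by blast
      moreover have "full U L A S g" unfolding full_def
      proof (intro ballI impI)
        fix v assume v: "v \<in> S" "g v \<notin> A"
        have "g x = c" using g(3) by (simp add: f'_def)
        then have "v \<in> ?S" using v c(1) by auto
        then show "A \<inter> L v \<subseteq> g ` back_nbrs U v" using g(2)[unfolded full_def, THEN bspec, THEN mp] v(2) by blast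
      qed
      moreover have "\<forall>v. v \<notin> S \<longrightarrow> g v = f v" using g(3) x by (auto simp: f'_def)
      ultimately show ?thesis unfolding Suc.hyps(2)[symmetric] by (intro exI[of _ g]) simp
    qed
  qed
qed

end

section \<open>One more block of colours\<close>

text \<open>The inductive step is packaged as a locale: \<open>fewer_colours\<close> is the
  induction hypothesis, for palettes with \<open>a\<close> colours less. \<open>p_pos\<close>
  provides room for three disjoint sets of \<open>a\<close> colours in \<open>K\<close>.\<close>

locale recolouring_step = adjacency E for E :: "'v::linorder \<Rightarrow> 'v \<Rightarrow> bool" +
  fixes U :: "'v set" and L :: "'v \<Rightarrow> 'c set" and K :: "'c set" and a N p F :: nat
  assumes finite_U: "finite U" and card_U: "card U \<le> N"
    and finite_K: "finite K" and card_K: "card K = (p + 2) * a"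
    and L_subset: "\<And>v. v \<in> U \<Longrightarrow> L v \<subseteq> K"
    and feasible: "feasible U L a"
    and p_pos: "p > 0"
    and fewer_colours: "\<And>W L' K' f g. finite W \<Longrightarrow> card W \<le> N \<Longrightarrow> finite K' \<Longrightarrow>
      card K' = (p + 1) * a \<Longrightarrow> (\<And>v. v \<in> W \<Longrightarrow> L' v \<subseteq> K') \<Longrightarrow> feasible W L' a \<Longrightarrow>
      list_colouring W L' f \<Longrightarrow> list_colouring W L' g \<Longrightarrow> (\<And>x. x \<notin> W \<Longrightarrow> f x = g x) \<Longrightarrow>
      reach W L' (f :: 'v \<Rightarrow> 'c) g F"
begin

lemma card_subset_U: "S \<subseteq> U \<Longrightarrow> card S \<le> N"
  using card_U by (blast intro: card_mono[OF finite_U] le_trans)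

text \<open>Both colourings restrict to the residual instance, whose palette \<open>K - A\<close> is
  small enough for the induction hypothesis. The sequence found there lifts to \<open>U\<close> by
  \<open>valid_moves_extend\<close>.\<close>

lemma reach_off_full:
  assumes "A \<subseteq> K" "card A = a" "up_closed U S" "list_colouring U L f" "full U L A S f"
    and "list_colouring U L g" "\<And>v. v \<notin> S \<or> f v \<in> A \<Longrightarrow> g v = f v"
    and "\<And>v. v \<in> S \<Longrightarrow> f v \<notin> A \<Longrightarrow> g v \<notin> A"
  shows "reach U L f g F"
proof -
  let ?W = "{v\<in>S. f v \<notin> A}"
  let ?L' = "residual_lists U L A S f"
  have SU: "S \<subseteq> U" using assms(3) by (simp add: up_closed_def)
  have W: "?W \<subseteq> U" using SU by auto
  have ok: "list_colouring ?W ?L' h"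
    if h: "list_colouring U L h" "\<And>v. v \<notin> S \<Longrightarrow> h v = f v" "\<And>v. v \<in> ?W \<Longrightarrow> h v \<notin> A" for h
    unfolding list_colouring_def
  proof (intro conjI ballI impI)
    fix v assume v: "v \<in> ?W"
    have "h v \<noteq> f u" if "u \<in> back_nbrs U v - S" for u
    proof -
      have "h u \<noteq> h v" using h(1) that v SU by (auto simp: list_colouring_def back_nbrs_def)
      then show ?thesis using h(2) that by auto
    qed
    moreover have "h v \<in> L v" using h(1) v SU by (auto simp: list_colouring_def)
    ultimately show "h v \<in> ?L' v" using h(3)[OF v] by (auto simp: residual_lists_def)
  qed (use h(1) SU in \<open>auto simp: list_colouring_def\<close>)
  have "reach ?W ?L' f g F"
  proof (rule fewer_colours)
    show "finite ?W" using W finite_U finite_subset by blast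
    show "card ?W \<le> N" using W by (rule card_subset_U)
    show "finite (K - A)" using finite_K by simp
    show "card (K - A) = (p + 1) * a"
      using assms(1,2) finite_K card_K by (simp add: card_Diff_subset finite_subset)
    show "?L' v \<subseteq> K - A" if "v \<in> ?W" for v
      using that L_subset SU by (auto simp: residual_lists_def)
    show "feasible ?W ?L' a"
      using finite_U feasible SU assms(5) by (rule feasible_residual_lists)
    show "list_colouring ?W ?L' f" using ok[of f] assms(4) by auto
    show "list_colouring ?W ?L' g" using ok[of g] assms(6-8) by auto
    show "f x = g x" if "x \<notin> ?W" for x using that assms(7)[of x] by auto
  qed
  then obtain ms where ms: "valid_moves ?W ?L' f ms" "apply_moves f ms = g" "length ms \<le> F"
    unfolding reach_def by blast
  have "valid_moves U L f ms"
  proof (rule valid_moves_extend[OF W assms(4) _ ms(1)])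
    fix w assume w: "w \<in> ?W"
    show "?L' w \<subseteq> {c \<in> L w. \<forall>u \<in> U - ?W. E u w \<longrightarrow> f u \<noteq> c}"
      using back_nbrs_outside_up_closed[OF assms(3), of w] w
      by (fastforce simp: residual_lists_def)
  qed
  with ms show ?thesis unfolding reach_def by blast
qed

text \<open>The residual instance keeps slack \<open>a\<close>, so it has a greedy colouring that
  also avoids \<open>B\<close>. Vertices coloured from \<open>A\<close> avoid \<open>B\<close> by
  disjointness.\<close>

lemma reach_free_of_disjoint:
  assumes "A \<subseteq> K" "card A = a" "up_closed U S" "list_colouring U L f" "full U L A S f"
    and "B \<subseteq> K" "card B = a" "A \<inter> B = {}"
  shows "\<exists>g. reach U L f g F \<and> (\<forall>v\<in>S. g v \<notin> B) \<and> (\<forall>v. v \<notin> S \<longrightarrow> g v = f v)"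
proof -
  let ?W = "{v\<in>S. f v \<notin> A}"
  let ?L' = "residual_lists U L A S f"
  have SU: "S \<subseteq> U" using assms(3) by (simp add: up_closed_def)
  have "feasible ?W ?L' a" using finite_U feasible SU assms(5) by (rule feasible_residual_lists)
  then have "feasible ?W (\<lambda>v. ?L' v - B) 0"
    using assms(6,7) finite_K finite_subset by (intro feasible_diff) auto
  moreover have "finite ?W" using SU finite_U finite_subset by (metis (no_types, lifting) mem_Collect_eq subset_iff)
  ultimately obtain g where g: "list_colouring ?W (\<lambda>v. ?L' v - B) g" "\<forall>x. x \<notin> ?W \<longrightarrow> g x = f x"
    using exists_list_colouring by blast
  have gW: "g v \<in> L v" "g v \<notin> A" "g v \<notin> B" "g v \<notin> f ` (back_nbrs U v - S)" if "v \<in> ?W" for v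
    using g(1) that by (auto simp: list_colouring_def residual_lists_def)
  \<comment> \<open>A fixed neighbour in \<open>S\<close> has a colour of \<open>A\<close>, which
    \<open>g\<close> avoids on \<open>?W\<close>; one outside \<open>S\<close> comes earlier, and
    its colour is not in the residual list.\<close>
  have mixed: "g u \<noteq> g v" if "u \<in> U - ?W" "v \<in> ?W" "E u v" for u v
  proof (cases "u \<in> S")
    case True
    then show ?thesis using that g(2) gW(2)[OF that(2)] by auto
  next
    case False
    then have "u \<in> back_nbrs U v - S"
      using back_nbrs_outside_up_closed[OF assms(3)] that by auto
    then show ?thesis using gW(4)[OF that(2)] g(2) False by (metis (no_types, lifting) image_eqI mem_Collect_eq)
  qed
  have ok: "list_colouring U L g"
    unfolding list_colouring_def
  proof (intro conjI ballI impI)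
    fix v assume "v \<in> U"
    then show "g v \<in> L v" using gW(1) g(2) assms(4) by (cases "v \<in> ?W") (auto simp: list_colouring_def)
  next
    fix u v assume uv: "u \<in> U" "v \<in> U" "E u v"
    consider "u \<in> ?W" "v \<in> ?W" | "u \<in> ?W" "v \<notin> ?W" | "u \<notin> ?W" "v \<in> ?W" | "u \<notin> ?W" "v \<notin> ?W"
      by blast
    then show "g u \<noteq> g v"
    proof cases
      case 1
      then show ?thesis using g(1) uv by (auto simp: list_colouring_def)
    next
      case 2
      then show ?thesis using mixed[of v u] uv sym by (metis DiffI)
    next
      case 3
      then show ?thesis using mixed[of u v] uv by blast
    next
      case 4
      then show ?thesis using g(2) uv assms(4) by (auto simp: list_colouring_def)
    qed
  qed
  have "reach U L f g F"
    by (rule reach_off_full[OF assms(1-5) ok]) (use g(2) gW in auto)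
  moreover have "\<forall>v\<in>S. g v \<notin> B"
  proof
    fix v assume "v \<in> S"
    then show "g v \<notin> B" using gW(3)[of v] g(2) assms(8) by (cases "v \<in> ?W") auto
  qed
  ultimately show ?thesis using g(2) by auto
qed

text \<open>As \<open>B\<close> may meet \<open>A\<close>, the exchange passes through a set
  \<open>D\<close> disjoint from both: free \<open>D\<close>, make it full on \<open>S\<close>, use
  it to free \<open>B\<close>, then make \<open>B\<close> full on \<open>T\<close>.\<close>

lemma reach_full_of_full:
  assumes "A \<subseteq> K" "card A = a" "up_closed U S" "list_colouring U L f" "full U L A S f"
    and "B \<subseteq> K" "card B = a" "up_closed U T" "S \<subseteq> T" "\<And>v. v \<in> T - S \<Longrightarrow> f v \<notin> B"
  shows "\<exists>g. reach U L f g (2 * F + 2 * N) \<and> full U L B T g \<and> (\<forall>v. v \<notin> T \<longrightarrow> g v = f v)"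
proof -
  have "card (A \<union> B) \<le> 2 * a" using card_Un_le[of A B] assms(2,7) by simp
  moreover have "card K - card (A \<union> B) \<le> card (K - (A \<union> B))"
    using assms(1,6) finite_K by (intro diff_card_le_card_Diff) (auto intro: finite_subset)
  moreover have "3 * a \<le> card K" unfolding card_K using p_pos by (intro mult_right_mono) auto
  ultimately have "a \<le> card (K - (A \<union> B))" by linarith
  then obtain D where D: "D \<subseteq> K - (A \<union> B)" "card D = a" by (meson obtain_subset_with_card_n)
  obtain f1 where f1: "reach U L f f1 F" "\<forall>v\<in>S. f1 v \<notin> D" "\<forall>v. v \<notin> S \<longrightarrow> f1 v = f v"
    using reach_free_of_disjoint[OF assms(1-5), of D] D by auto
  have ok1: "list_colouring U L f1" using f1(1) assms(4) reach_list_colouring by blast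
  obtain f2 where f2: "reach U L f1 f2 (card S)" "full U L D S f2" "\<forall>v. v \<notin> S \<longrightarrow> f2 v = f1 v"
    using reach_full[OF finite_U assms(3) ok1] f1(2) by blast
  have ok2: "list_colouring U L f2" using f2(1) ok1 reach_list_colouring by blast
  obtain f3 where f3: "reach U L f2 f3 F" "\<forall>v\<in>S. f3 v \<notin> B" "\<forall>v. v \<notin> S \<longrightarrow> f3 v = f2 v"
    using reach_free_of_disjoint[OF _ _ assms(3) ok2 f2(2) assms(6,7)] D by auto
  have ok3: "list_colouring U L f3" using f3(1) ok2 reach_list_colouring by blast
  \<comment> \<open>On \<open>T - S\<close> the colours are still those of \<open>f\<close>, which
    avoid \<open>B\<close> by assumption.\<close>
  have "f3 v \<notin> B" if "v \<in> T" for v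
    using that assms(10) f1(3) f2(3) f3(2,3) by (cases "v \<in> S") auto
  then obtain g where g: "reach U L f3 g (card T)" "full U L B T g" "\<forall>v. v \<notin> T \<longrightarrow> g v = f3 v"
    using reach_full[OF finite_U assms(8) ok3] by blast
  have "reach U L f g (F + card S + F + card T)"
    by (rule reach_trans[OF reach_trans[OF reach_trans[OF f1(1) f2(1)] f3(1)] g(1)])
  moreover have "card S \<le> N" "card T \<le> N"
    using assms(3,8) card_subset_U by (auto simp: up_closed_def)
  ultimately have "reach U L f g (2 * F + 2 * N)" by (elim reach_mono) simp
  moreover have "\<forall>v. v \<notin> T \<longrightarrow> g v = f v" using f1(3) f2(3) f3(3) g(3) assms(9) by auto
  ultimately show ?thesis using g(2) by blast
qed

text \<open>
  Extending by blocks of \<open>a\<close> vertices, rather than one vertex at a time, saves the factor \<open>a\<close> that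
  the base case \<open>p = 1\<close> costs; without this the constants would depend on \<open>k\<close> and \<open>d\<close>.
\<close>

lemma reach_full_everywhere:
  assumes "A \<subseteq> K" "card A = a" "up_closed U S" "list_colouring U L f" "full U L A S f"
    and "card (U - S) \<le> b * a"
  shows "\<exists>g B. B \<subseteq> K \<and> card B = a \<and> reach U L f g (b * (2 * F + 2 * N)) \<and> full U L B U g"
  using assms
proof (induction b arbitrary: A S f)
  case 0
  then have "U - S = {}" using finite_U by simp
  then have "S = U" using 0 by (auto simp: up_closed_def)
  then show ?case using 0 reach_refl by blast
next
  case (Suc b)
  have SU: "S \<subseteq> U" using Suc.prems(3) by (simp add: up_closed_def)
  obtain T0 where T0: "T0 \<subseteq> U - S" "card T0 \<le> a" "card (U - S - T0) \<le> card (U - S) - a"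
    "\<forall>x \<in> T0. \<forall>y \<in> U - S - T0. y < x"
    using exists_top_segment[of "U - S" a] finite_U by auto
  let ?T = "S \<union> T0"
  have up: "up_closed U ?T"
    unfolding up_closed_def
  proof (intro conjI ballI impI)
    fix v u assume v: "v \<in> ?T" and u: "u \<in> U" "v < u"
    show "u \<in> ?T"
    proof (cases "v \<in> S")
      case True
      then show ?thesis using u Suc.prems(3) by (auto simp: up_closed_def)
    next
      case False
      then have "v \<in> T0" using v by simp
      then have "u \<notin> U - S - T0" using T0(4) u less_asym by blast
      then show ?thesis using u by simp
    qed
  qed (use SU T0(1) in auto)
  have "finite T0" using T0(1) finite_U finite_subset by blast
  then have "card (f ` T0) \<le> a" using card_image_le T0(2) le_trans by blast
  moreover have "card K - card (f ` T0) \<le> card (K - f ` T0)"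
    using \<open>finite T0\<close> by (intro diff_card_le_card_Diff) auto
  ultimately have "a \<le> card (K - f ` T0)"
    using card_K by (simp add: algebra_simps)
  then obtain B where B: "B \<subseteq> K - f ` T0" "card B = a" by (meson obtain_subset_with_card_n)
  have BK: "B \<subseteq> K" using B by auto
  have "f v \<notin> B" if "v \<in> ?T - S" for v using that B by auto
  then obtain f1 where f1: "reach U L f f1 (2 * F + 2 * N)" "full U L B ?T f1"
    using reach_full_of_full[OF Suc.prems(1-5) BK B(2) up] by blast
  have ok1: "list_colouring U L f1" using f1(1) Suc.prems(4) reach_list_colouring by blast
  have "U - ?T = U - S - T0" by auto
  then have "card (U - ?T) \<le> b * a" using T0(3) Suc.prems(6) by simp
  then obtain g B' where g: "B' \<subseteq> K" "card B' = a" "reach U L f1 g (b * (2 * F + 2 * N))"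
    "full U L B' U g"
    using Suc.IH[OF BK B(2) up ok1 f1(2)] by blast
  have "reach U L f g (2 * F + 2 * N + b * (2 * F + 2 * N))"
    using f1(1) g(3) reach_trans by blast
  then show ?case using g by (intro exI[of _ g] exI[of _ B']) simp
qed

text \<open>Starting from the empty segment, \<open>q\<close> extensions make some set
  \<open>B\<close> full everywhere. One more exchange replaces \<open>B\<close> by the prescribed
  \<open>A\<close>, after which \<open>h\<close> is reached in two phases.\<close>

lemma reach_canonical:
  assumes "A \<subseteq> K" "card A = a" "N \<le> q * a"
    and "list_colouring U (\<lambda>v. L v - A) h" "list_colouring U L f" "\<And>x. x \<notin> U \<Longrightarrow> f x = h x"
  shows "reach U L f h ((q + 1) * (2 * F + 2 * N) + F + N)"
proof -
  have h: "list_colouring U L h" "\<And>v. v \<in> U \<Longrightarrow> h v \<notin> A"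
    using assms(4) by (auto simp: list_colouring_def)
  have "card (U - {}) \<le> q * a" using card_U assms(3) by simp
  moreover have "full U L A {} f" by (simp add: full_def)
  ultimately obtain f1 B where f1: "B \<subseteq> K" "card B = a" "reach U L f f1 (q * (2 * F + 2 * N))"
    "full U L B U f1"
    using reach_full_everywhere[OF assms(1,2) up_closed_empty assms(5), of q] by blast
  have ok1: "list_colouring U L f1" using f1(3) assms(5) reach_list_colouring by blast
  obtain f2 where f2: "reach U L f1 f2 (2 * F + 2 * N)" "full U L A U f2"
    using reach_full_of_full[OF f1(1,2) up_closed_self ok1 f1(4) assms(1,2) up_closed_self] by auto
  have ok2: "list_colouring U L f2" using f2(1) ok1 reach_list_colouring by blast
  \<comment> \<open>The vertices coloured from \<open>A\<close> wait while the others take their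
    colours in \<open>h\<close>. Since \<open>h\<close> avoids \<open>A\<close>, the mixture is
    proper, and the waiting vertices can then follow in any order.\<close>
  define g where "g v = (if v \<in> U \<and> f2 v \<notin> A then h v else f2 v)" for v
  have okg: "list_colouring U L g"
    unfolding list_colouring_def
  proof (intro conjI ballI impI)
    show "g v \<in> L v" if "v \<in> U" for v
      using that ok2 h(1) by (auto simp: g_def list_colouring_def)
    show "g u \<noteq> g v" if "u \<in> U" "v \<in> U" "E u v" for u v
      using that ok2 h(1) h(2)[of u] h(2)[of v]
      by (cases "f2 u \<in> A"; cases "f2 v \<in> A") (auto simp: g_def list_colouring_def)
  qed
  have "reach U L f2 g F"
    by (rule reach_off_full[OF assms(1,2) up_closed_self ok2 f2(2) okg]) (auto simp: g_def h(2))
  moreover have "reach U L g h (card U)"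
  proof (rule reach_pointwise[OF finite_U subset_refl okg h(1)])
    show "g v = h v" if "v \<notin> U" for v
      using that f1(3) f2(1) assms(6) by (simp add: g_def reach_outside)
    show "g u \<noteq> h v" if "u \<in> U" "v \<in> U" "E u v" for u v
      using that h by (auto simp: g_def list_colouring_def)
  qed
  ultimately have "reach U L f h (q * (2 * F + 2 * N) + (2 * F + 2 * N) + F + card U)"
    using reach_trans[OF reach_trans[OF f1(3) f2(1)]] reach_trans by blast
  then show ?thesis using card_U by (elim reach_mono) simp
qed

text \<open>Both colourings are led to a common \<open>h\<close> avoiding \<open>A\<close>, and the
  second sequence is reversed. Twice the cost in \<open>reach_canonical\<close> is
  \<open>(4 * q + 6) * (F + N)\<close>.\<close>

lemma reach_one_more_block:
  assumes "N \<le> q * a"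
    and "list_colouring U L f" "list_colouring U L g" "\<And>x. x \<notin> U \<Longrightarrow> f x = g x"
  shows "reach U L f g ((4 * q + 6) * (F + N))"
proof -
  have "a \<le> card K" using card_K by simp
  then obtain A where A: "A \<subseteq> K" "card A = a" by (meson obtain_subset_with_card_n)
  have "feasible U (\<lambda>v. L v - A) 0"
    using feasible A finite_K finite_subset by (intro feasible_diff) auto
  then obtain h where h: "list_colouring U (\<lambda>v. L v - A) h" "\<forall>x. x \<notin> U \<longrightarrow> h x = f x"
    using exists_list_colouring[OF finite_U] by blast
  let ?m = "(q + 1) * (2 * F + 2 * N) + F + N"
  have "reach U L f h ?m" using reach_canonical[OF A assms(1) h(1) assms(2)] h(2) by simp
  moreover have "reach U L g h ?m"
    using reach_canonical[OF A assms(1) h(1) assms(3)] h(2) assms(4) by simp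
  then have "reach U L h g ?m" using assms(3) by (rule reach_sym)
  ultimately have "reach U L f g (?m + ?m)" by (rule reach_trans)
  then show ?thesis by (simp add: algebra_simps)
qed

end

section \<open>Induction on the number of colour blocks\<close>

context adjacency
begin

lemma reach_blocks:
  fixes L :: "'v \<Rightarrow> 'c set"
  assumes "0 < a" "a \<le> N"
    and "finite U" "card U \<le> N" "finite K" "card K = (p + 2) * a" "\<And>v. v \<in> U \<Longrightarrow> L v \<subseteq> K"
    and "feasible U L a" "list_colouring U L f" "list_colouring U L g" "\<And>x. x \<notin> U \<Longrightarrow> f x = g x"
  shows "\<exists>m. reach U L f g m \<and> real m \<le> 30 ^ (p + 1) * (real a * real N) * (real N / real a) ^ p"
proof -
  \<comment> \<open>One \<open>F\<close> has to serve all instances, because the inductive step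
    applies the hypothesis to residual instances with other vertices, lists and palettes.\<close>
  let ?P = "\<lambda>p F. \<forall>U (L :: 'v \<Rightarrow> 'c set) K f g.
      finite U \<longrightarrow> card U \<le> N \<longrightarrow> finite K \<longrightarrow> card K = (p + 2) * a \<longrightarrow>
      (\<forall>v\<in>U. L v \<subseteq> K) \<longrightarrow> feasible U L a \<longrightarrow> list_colouring U L f \<longrightarrow> list_colouring U L g \<longrightarrow>
      (\<forall>x. x \<notin> U \<longrightarrow> f x = g x) \<longrightarrow> reach U L f g F"
  have "\<exists>F. real F \<le> 30 ^ (p + 1) * (real a * real N) * (real N / real a) ^ p \<and> ?P p F"
  proof (induction p)
    case 0
    have "reach U L f g (a * N)"
      if U: "finite U" "card U \<le> N" "finite K" "card K = (0 + 2) * a" "\<forall>v\<in>U. L v \<subseteq> K"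
        and ok: "feasible U L a" "list_colouring U L f" "list_colouring U L g"
          "\<forall>x. x \<notin> U \<longrightarrow> f x = g x"
      for U K f g and L :: "'v \<Rightarrow> 'c set"
    proof -
      have "card (back_nbrs U v) < a" if "v \<in> U" for v
      proof -
        have "card (L v) \<le> (0 + 2) * a" using U that card_mono by metis
        moreover have "card (back_nbrs U v) + 1 + a \<le> card (L v)"
          using ok(1) that by (auto simp: feasible_def)
        ultimately show ?thesis by simp
      qed
      then have "reach U L f g (a * card U)"
        using U(1) ok by (intro reach_small_back_degree) auto
      then show ?thesis using U(2) by (elim reach_mono) simp
    qed
    then have "?P 0 (a * N)" by (intro allI impI)
    moreover have "real (a * N) \<le> 30 ^ (0 + 1) * (real a * real N) * (real N / real a) ^ 0" by simp
    ultimately show ?case by (intro exI[of _ "a * N"] conjI)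
  next
    case (Suc p)
    define X where "X = 30 ^ (p + 1) * (real a * real N) * (real N / real a) ^ p"
    from Suc.IH obtain F where FX: "real F \<le> X" and F: "?P p F"
      unfolding X_def by (elim exE conjE)
    define q where "q = N div a + 1"
    have Nq: "N \<le> q * a"
      unfolding q_def using assms(1) dividend_less_div_times[of a N] by (simp add: algebra_simps)
    have reach: "reach U L f g ((4 * q + 6) * (F + N))"
      if U: "finite U" "card U \<le> N" "finite K" "card K = (Suc p + 2) * a" "\<forall>v\<in>U. L v \<subseteq> K"
        and ok: "feasible U L a" "list_colouring U L f" "list_colouring U L g"
          "\<forall>x. x \<notin> U \<longrightarrow> f x = g x"
      for U K f g and L :: "'v \<Rightarrow> 'c set"
    proof -
      interpret recolouring_step E U L K a N "Suc p" F
      proof unfold_locales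
        show "reach W L' f g F"
          if "finite W" "card W \<le> N" "finite K'" "card K' = (Suc p + 1) * a"
            "\<And>v. v \<in> W \<Longrightarrow> L' v \<subseteq> K'" "feasible W L' a" "list_colouring W L' f"
            "list_colouring W L' g" "\<And>x. x \<notin> W \<Longrightarrow> f x = g x"
          for W K' f g and L' :: "'v \<Rightarrow> 'c set"
          by (rule F[rule_format, OF that(1-3) _ _ that(6-8)]) (simp_all add: that(4,5,9))
        show "L v \<subseteq> K" if "v \<in> U" for v using U(5) that by blast
      qed (fact U ok(1) zero_less_Suc)+
      show ?thesis by (rule reach_one_more_block[OF Nq ok(2,3)]) (simp add: ok(4))
    qed
    have ratio: "real N / real a \<ge> 1" using assms(1,2) by simp
    have "real (N div a) \<le> real N / real a" by (rule of_nat_div_le_of_nat)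
    \<comment> \<open>Since \<open>N / a\<close> is at least \<open>1\<close>,
      \<open>4 * q + 6 \<le> 4 * (N / a) + 10 \<le> 14 * (N / a)\<close>. With
      \<open>F + N \<le> 2 * X\<close> the factor is 28, rounded up to 30.\<close>
    then have "4 * real q + 6 \<le> 14 * (real N / real a)"
      using ratio by (simp add: q_def)
    moreover have "real N \<le> X"
    proof -
      have "1 * (1 * real N) * 1 \<le> X"
        unfolding X_def using ratio assms(1) one_le_power[of "30::real" "p + 1"]
        by (intro mult_mono one_le_power) auto
      then show ?thesis by simp
    qed
    ultimately have "(4 * real q + 6) * (real F + real N) \<le> (14 * (real N / real a)) * (X + X)"
      using FX by (intro mult_mono add_mono) auto
    also have "\<dots> \<le> 30 * (real N / real a) * X"
    proof -
      have "14 * r * (X + X) \<le> 30 * r * X" if "0 \<le> r * X" for r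
        using that by (simp add: algebra_simps)
      moreover have "0 \<le> (real N / real a) * X" using ratio \<open>real N \<le> X\<close> by simp
      ultimately show ?thesis .
    qed
    also have "\<dots> = 30 ^ (Suc p + 1) * (real a * real N) * (real N / real a) ^ Suc p"
      by (simp add: X_def)
    finally have "real ((4 * q + 6) * (F + N))
        \<le> 30 ^ (Suc p + 1) * (real a * real N) * (real N / real a) ^ Suc p" by simp
    moreover have "?P (Suc p) ((4 * q + 6) * (F + N))" using reach by (intro allI impI)
    ultimately show ?case by (intro exI[of _ "(4 * q + 6) * (F + N)"] conjI)
  qed
  then obtain F where "real F \<le> 30 ^ (p + 1) * (real a * real N) * (real N / real a) ^ p"
    and F: "?P p F" by (elim exE conjE)
  moreover have "reach U L f g F"
    by (rule F[rule_format, OF assms(3-6) _ assms(8-10)]) (simp_all add: assms(7,11))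
  ultimately show ?thesis by blast
qed

end

section \<open>From degenerate graphs to ordered list colourings\<close>

lemma pair_graph_induced:
  assumes "pair_graph G" "S \<subseteq> pverts G"
  shows "pair_graph \<lparr>pverts = S, parcs = parcs G \<inter> S \<times> S\<rparr>"
proof -
  interpret pair_graph G by fact
  have "finite S" using assms(2) pair_finite_verts finite_subset by blast
  moreover have "(y, x) \<in> parcs G" if "(x, y) \<in> parcs G" for x y
    using pair_sym_arcs that by (auto simp: symmetric_def elim: symE)
  ultimately show ?thesis
    using pair_finite_arcs pair_no_loops
    by unfold_locales (auto simp: symmetric_def intro!: symI)
qed

text \<open>Peel off a vertex of degree at most \<open>d\<close> in the induced subgraph on
  \<open>S\<close>, order the rest recursively, and put that vertex last.\<close>

lemma exists_degenerate_ordering: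
  assumes "pair_graph G" "degenerate d G"
  shows "\<exists>e :: nat \<Rightarrow> 'a. bij_betw e {..<card (pverts G)} (pverts G) \<and>
    (\<forall>i<card (pverts G). card {j. j < i \<and> (e j, e i) \<in> parcs G} \<le> d)"
proof -
  interpret pair_graph G by fact
  have "\<exists>e. bij_betw e {..<n} S \<and> (\<forall>i<n. card {j. j < i \<and> (e j, e i) \<in> parcs G} \<le> d)"
    if "S \<subseteq> pverts G" "card S = n" for S n
    using that
  proof (induction n arbitrary: S)
    case 0
    then have "S = {}" using pair_finite_verts finite_subset by fastforce
    then show ?case by (simp add: bij_betw_def)
  next
    case (Suc n)
    let ?H = "\<lparr>pverts = S, parcs = parcs G \<inter> S \<times> S\<rparr>"
    have H: "pair_graph ?H" using assms(1) Suc.prems(1) by (rule pair_graph_induced)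
    interpret H: pair_graph ?H by (rule H)
    have "subgraph (with_proj ?H) (with_proj G)"
      using Suc.prems(1) H.wf_digraph_axioms wf_digraph_axioms
      by (auto simp: subgraph_def compatible_def)
    moreover have "pverts ?H \<noteq> {}" using Suc.prems(2) by auto
    ultimately have "\<exists>v\<in>pverts ?H. out_degree (with_proj ?H) v \<le> d"
      using assms(2)[unfolded degenerate_def, THEN spec[of _ ?H]] H by blast
    then obtain v where v: "v \<in> S" "out_degree (with_proj ?H) v \<le> d" by auto
    have "card (S - {v}) = n" using Suc.prems(2) v(1) by simp
    then obtain e where e: "bij_betw e {..<n} (S - {v})"
      "\<forall>i<n. card {j. j < i \<and> (e j, e i) \<in> parcs G} \<le> d"
      using Suc.IH[of "S - {v}"] Suc.prems(1) by blast
    let ?e = "e(n := v)"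
    have "bij_betw ?e {..<n} (S - {v})" using e(1) by (subst bij_betw_cong[of _ _ e]) auto
    then have bij: "bij_betw ?e {..<Suc n} S"
      using v(1) notIn_Un_bij_betw[of n "{..<n}" ?e "S - {v}"]
      by (simp add: lessThan_Suc insert_absorb)
    have "card {j. j < i \<and> (?e j, ?e i) \<in> parcs G} \<le> d" if "i < Suc n" for i
    proof (cases "i = n")
      case False
      then have "{j. j < i \<and> (?e j, ?e i) \<in> parcs G} = {j. j < i \<and> (e j, e i) \<in> parcs G}"
        using that by auto
      then show ?thesis using e(2) that False by simp
    next
      case True
      have inj: "inj_on e {..<n}" and img: "e ` {..<n} = S - {v}" using e(1) by (auto simp: bij_betw_def)
      have "inj_on (\<lambda>j. (v, e j)) {j. j < i \<and> (?e j, ?e i) \<in> parcs G}"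
        using inj True by (auto simp: inj_on_def)
      moreover have "(\<lambda>j. (v, e j)) ` {j. j < i \<and> (?e j, ?e i) \<in> parcs G} \<subseteq> out_arcs (with_proj ?H) v"
        using True img v(1) pair_sym_arcs by (auto simp: out_arcs_def symmetric_def elim: symE)
      moreover have "finite (out_arcs (with_proj ?H) v)"
        using H.pair_finite_arcs by (simp add: out_arcs_def)
      ultimately have "card {j. j < i \<and> (?e j, ?e i) \<in> parcs G} \<le> card (out_arcs (with_proj ?H) v)"
        by (rule card_inj_on_le)
      then show ?thesis using v(2) by (simp add: out_degree_def)
    qed
    then show ?case using bij by blast
  qed
  then show ?thesis by blast
qed

section \<open>Diameter bounds from recolouring sequences\<close>

lemma graph_diameter_le:
  assumes "wf_digraph G"
    and "\<And>u v. u \<in> verts G \<Longrightarrow> v \<in> verts G \<Longrightarrow>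
      \<exists>p. pre_digraph.awalk G u p v \<and> real (length p) \<le> B"
  shows "graph_diameter G \<le> ereal B"
  unfolding graph_diameter_def
proof (intro SUP_least)
  fix u v assume "u \<in> verts G" "v \<in> verts G"
  then obtain p where p: "pre_digraph.awalk G u p v" "real (length p) \<le> B" using assms(2) by blast
  interpret wf_digraph G by (rule assms(1))
  have "awalk_cost (\<lambda>_. 1) p = real (length p)" by (induction p) auto
  then show "wf_digraph.\<mu> G (\<lambda>_. 1) u v \<le> ereal B"
    using min_cost_le_walk_cost[OF p(1), of "\<lambda>_. 1"] p(2) by (elim order_trans) simp
qed

text \<open>Vertices are replaced by their indices, because \<open>adjacency\<close> needs a linear
  order on the vertex type.\<close>

locale ordered_graph =
  fixes G :: "'a pair_pre_digraph" and e :: "nat \<Rightarrow> 'a" and n d :: nat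
  assumes pair_graph: "pair_graph G"
    and bij: "bij_betw e {..<n} (pverts G)"
    and back_degree: "\<And>i. i < n \<Longrightarrow> card {j. j < i \<and> (e j, e i) \<in> parcs G} \<le> d"
begin

definition E :: "nat \<Rightarrow> nat \<Rightarrow> bool" where
  "E i j \<longleftrightarrow> (e i, e j) \<in> parcs G"

sublocale adjacency E
proof -
  interpret pair_graph G by (rule pair_graph)
  show "adjacency E"
  proof
    show "E v u" if "E u v" for u v
      using that pair_sym_arcs by (auto simp: E_def symmetric_def elim: symE)
    show "\<not> E v v" for v using pair_no_loops[of "(e v, e v)"] by (auto simp: E_def)
  qed
qed

lemma card_back_nbrs: "i < n \<Longrightarrow> card (back_nbrs {..<n} i) \<le> d"
proof -
  assume i: "i < n"
  then have "back_nbrs {..<n} i = {j. j < i \<and> (e j, e i) \<in> parcs G}"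
    by (auto simp: back_nbrs_def E_def)
  then show ?thesis using back_degree[OF i] by simp
qed

definition colouring_of :: "(nat \<Rightarrow> nat) \<Rightarrow> 'a \<Rightarrow> nat" where
  "colouring_of f = (\<lambda>x\<in>pverts G. f (the_inv_into {..<n} e x))"

text \<open>The default \<open>0\<close> makes all indexed colourings agree outside
  \<open>{..<n}\<close>, as reachability by moves requires.\<close>

definition indexed_colouring :: "('a \<Rightarrow> nat) \<Rightarrow> nat \<Rightarrow> nat" where
  "indexed_colouring h i = (if i < n then h (e i) else 0)"

lemma e_in_verts: "i < n \<Longrightarrow> e i \<in> pverts G"
  using bij by (auto simp: bij_betw_def)

lemma colouring_of_e: "i < n \<Longrightarrow> colouring_of f (e i) = f i"
  using bij e_in_verts by (simp add: colouring_of_def bij_betw_def the_inv_into_f_f)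

lemma vertex_cases:
  assumes "x \<in> pverts G" obtains i where "i < n" "x = e i"
  using assms bij by (auto simp: bij_betw_def)

lemma colouring_of_indexed:
  assumes "h \<in> extensional (pverts G)"
  shows "colouring_of (indexed_colouring h) = h"
proof
  fix x
  show "colouring_of (indexed_colouring h) x = h x"
  proof (cases "x \<in> pverts G")
    case True
    then show ?thesis
      by (elim vertex_cases) (simp add: colouring_of_e indexed_colouring_def)
  next
    case False
    then show ?thesis using assms by (simp add: colouring_of_def extensional_def)
  qed
qed

lemma colouring_of_proper:
  assumes "list_colouring {..<n} (\<lambda>_. {1..k}) f"
  shows "colouring_of f \<in> proper_colourings G k"
proof -
  interpret pair_graph G by (rule pair_graph)
  have "colouring_of f x \<in> {1..k}" if "x \<in> pverts G" for x
    using that assms by (elim vertex_cases) (auto simp: colouring_of_e list_colouring_def)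
  moreover have "colouring_of f x \<noteq> colouring_of f y" if xy: "(x, y) \<in> parcs G" for x y
  proof -
    obtain i j where "i < n" "j < n" "x = e i" "y = e j"
      using wellformed'[OF xy] by (metis vertex_cases)
    then show ?thesis using xy assms by (auto simp: colouring_of_e list_colouring_def E_def)
  qed
  moreover have "colouring_of f \<in> extensional (pverts G)" by (simp add: colouring_of_def)
  ultimately show ?thesis unfolding proper_colourings_def PiE_def by blast
qed

lemma indexed_colouring_proper:
  assumes "h \<in> proper_colourings G k"
  shows "list_colouring {..<n} (\<lambda>_. {1..k}) (indexed_colouring h)"
  using assms e_in_verts
  by (fastforce simp: list_colouring_def indexed_colouring_def proper_colourings_def E_def)

text \<open>Every move that changes a colour is an arc; idle moves are dropped, so the walk may be
  shorter than the sequence.\<close>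

lemma awalk_of_moves:
  assumes "list_colouring {..<n} (\<lambda>_. {1..k}) f" "valid_moves {..<n} (\<lambda>_. {1..k}) f ms"
  shows "\<exists>p. pre_digraph.awalk (with_proj (reconfiguration_graph G k))
    (colouring_of f) p (colouring_of (apply_moves f ms)) \<and> length p \<le> length ms"
  using assms
proof (induction ms arbitrary: f)
  case Nil
  interpret R: pair_wf_digraph "reconfiguration_graph G k" by (rule pair_wf_reconfiguration_graph)
  show ?case using colouring_of_proper[OF Nil(1)]
    by (intro exI[of _ "[]"]) (simp add: R.awalk_Nil_iff, simp add: reconfiguration_graph_def)
next
  case (Cons m ms)
  interpret R: pair_wf_digraph "reconfiguration_graph G k" by (rule pair_wf_reconfiguration_graph)
  obtain i c where m: "m = (i, c)" by (cases m)
  define f' where "f' = f(i := c)"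
  have i: "i < n" and f': "list_colouring {..<n} (\<lambda>_. {1..k}) f'"
    and ms: "valid_moves {..<n} (\<lambda>_. {1..k}) f' ms"
    using Cons.prems(2) by (auto simp: m f'_def)
  obtain p where p: "R.awalk (colouring_of f') p (colouring_of (apply_moves f' ms))"
    "length p \<le> length ms"
    using Cons.IH[OF f' ms] by blast
  have app: "apply_moves f (m # ms) = apply_moves f' ms" by (simp add: m f'_def)
  show ?case
  proof (cases "c = f i")
    case True
    then have "f' = f" by (simp add: f'_def)
    then show ?thesis using p app by (intro exI[of _ p]) simp
  next
    case False
    have "colouring_of f x \<noteq> colouring_of f' x \<longleftrightarrow> x = e i" if "x \<in> pverts G" for x
    proof -
      obtain j where j: "j < n" "x = e j" using \<open>x \<in> pverts G\<close> by (rule vertex_cases)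
      then have "x = e i \<longleftrightarrow> j = i" using bij i by (auto simp: bij_betw_def inj_on_def)
      then show ?thesis using j False by (auto simp: colouring_of_e f'_def)
    qed
    then have "\<exists>!x. x \<in> pverts G \<and> colouring_of f x \<noteq> colouring_of f' x"
      using e_in_verts[OF i] by blast
    then have "(colouring_of f, colouring_of f') \<in> parcs (reconfiguration_graph G k)"
      using colouring_of_proper[OF Cons.prems(1)] colouring_of_proper[OF f']
      by (simp add: reconfiguration_graph_def)
    then show ?thesis
      using p app by (intro exI[of _ "(colouring_of f, colouring_of f') # p"]) (simp add: R.awalk_Cons_iff)
  qed
qed

lemma diameter_le_of_reach:
  assumes "\<And>f g. list_colouring {..<n} (\<lambda>_. {1..k}) f \<Longrightarrow> list_colouring {..<n} (\<lambda>_. {1..k}) g \<Longrightarrow>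
      (\<And>i. i \<notin> {..<n} \<Longrightarrow> f i = g i) \<Longrightarrow>
      \<exists>m. reach {..<n} (\<lambda>_. {1..k}) f g m \<and> real m \<le> B"
  shows "graph_diameter (with_proj (reconfiguration_graph G k)) \<le> ereal B"
proof (rule graph_diameter_le)
  interpret R: pair_wf_digraph "reconfiguration_graph G k" by (rule pair_wf_reconfiguration_graph)
  show "wf_digraph (with_proj (reconfiguration_graph G k))" by (rule R.wf_digraph_axioms)
  fix u v assume "u \<in> verts (with_proj (reconfiguration_graph G k))"
    "v \<in> verts (with_proj (reconfiguration_graph G k))"
  then have uv: "u \<in> proper_colourings G k" "v \<in> proper_colourings G k"
    by (auto simp: reconfiguration_graph_def)
  let ?f = "indexed_colouring u" and ?g = "indexed_colouring v"
  have ok: "list_colouring {..<n} (\<lambda>_. {1..k}) ?f" "list_colouring {..<n} (\<lambda>_. {1..k}) ?g"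
    using uv indexed_colouring_proper by auto
  have "?f i = ?g i" if "i \<notin> {..<n}" for i using that by (simp add: indexed_colouring_def)
  then obtain m where m: "reach {..<n} (\<lambda>_. {1..k}) ?f ?g m" "real m \<le> B"
    using assms[OF ok] by blast
  then obtain ms where ms: "valid_moves {..<n} (\<lambda>_. {1..k}) ?f ms" "apply_moves ?f ms = ?g"
    "length ms \<le> m"
    unfolding reach_def by blast
  have "colouring_of ?f = u" "colouring_of ?g = v"
    using uv by (auto intro!: colouring_of_indexed simp: proper_colourings_def PiE_def)
  then show "\<exists>p. R.awalk u p v \<and> real (length p) \<le> B"
    using awalk_of_moves[OF ok(1) ms(1)] ms(2,3) m(2) by fastforce
qed

text \<open>Here the slack \<open>d + 1\<close> exceeds every back degree, so the case of few
  colours suffices alone.\<close>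

lemma diameter_le_linear:
  assumes "2 * d + 2 \<le> k"
  shows "graph_diameter (with_proj (reconfiguration_graph G k)) \<le> ereal ((real d + 1) * real n)"
proof (rule diameter_le_of_reach)
  fix f g
  assume fg: "list_colouring {..<n} (\<lambda>_. {1..k}) f" "list_colouring {..<n} (\<lambda>_. {1..k}) g"
    "\<And>i. i \<notin> {..<n} \<Longrightarrow> f i = g i"
  have "feasible {..<n} (\<lambda>_. {1..k}) (d + 1)"
    using card_back_nbrs assms by (fastforce simp: feasible_def)
  moreover have "card (back_nbrs {..<n} v) < d + 1" if "v \<in> {..<n}" for v
    using card_back_nbrs[of v] that by simp
  ultimately have "reach {..<n} (\<lambda>_. {1..k}) f g ((d + 1) * card {..<n})"
    using fg by (intro reach_small_back_degree) simp_all
  then show "\<exists>m. reach {..<n} (\<lambda>_. {1..k}) f g m \<and> real m \<le> (real d + 1) * real n"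
    by (intro exI conjI) (assumption, simp add: algebra_simps)
qed

text \<open>With \<open>a = k - d - 1\<close> the last assumption reads
  \<open>k \<le> (p + 1) * a\<close>, so the palette can be padded to \<open>p + 1\<close> blocks.
  The block bound equals \<open>30 ^ p * n ^ p / a ^ (p - 2)\<close>, where dropping the denominator
  removes the dependence on \<open>a\<close>.\<close>

lemma diameter_le_power:
  assumes "d < n" "d + 2 \<le> k" "2 \<le> p" "d + 1 \<le> p * (k - d - 1)"
  shows "graph_diameter (with_proj (reconfiguration_graph G k)) \<le> ereal (30 ^ p * real n ^ p)"
\<comment> \<open>If \<open>k\<close> is large, \<open>a\<close> might exceed \<open>n\<close>, and
  the linear bound is used. Otherwise \<open>a \<le> d < n\<close>, as the block bound
  needs.\<close>
proof (cases "2 * d + 2 \<le> k")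
  case True
  have "(real d + 1) * real n \<le> real n * real n" using assms(1) by (intro mult_right_mono) auto
  also have "\<dots> = 1 * real n ^ 2" by (simp add: power2_eq_square)
  also have "\<dots> \<le> 30 ^ p * real n ^ p"
    using assms(1,3) one_le_power[of "30::real" p] by (intro mult_mono power_increasing) auto
  finally show ?thesis using diameter_le_linear[OF True] order_trans by fastforce
next
  case False
  define a where "a = k - d - 1"
  have a: "0 < a" "a \<le> n" "k = d + 1 + a" "k \<le> (p + 1) * a" using assms False by (auto simp: a_def)
  obtain p' where p: "p = Suc (Suc p')" using assms(3) by (metis Suc_le_D numeral_2_eq_2 Suc_le_mono)
  show ?thesis
  proof (rule diameter_le_of_reach)
    fix f g
    assume fg: "list_colouring {..<n} (\<lambda>_. {1..k}) f" "list_colouring {..<n} (\<lambda>_. {1..k}) g"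
      "\<And>i. i \<notin> {..<n} \<Longrightarrow> f i = g i"
    have "feasible {..<n} (\<lambda>_. {1..k}) a"
      using card_back_nbrs a(3) by (fastforce simp: feasible_def)
    then obtain m where m: "reach {..<n} (\<lambda>_. {1..k}) f g m"
      "real m \<le> 30 ^ (Suc p' + 1) * (real a * real n) * (real n / real a) ^ Suc p'"
      using reach_blocks[OF a(1,2), of "{..<n}" "{1..(p + 1) * a}" "Suc p'" "\<lambda>_. {1..k}" f g] fg a(4)
      by (auto simp: p)
    note m(2)
    also have "30 ^ (Suc p' + 1) * (real a * real n) * (real n / real a) ^ Suc p'
        = 30 ^ p * (real n ^ p / real a ^ p')"
      using a(1) by (simp add: p power_divide)
    also have "\<dots> \<le> 30 ^ p * (real n ^ p / 1)"
      using a(1) by (intro mult_left_mono divide_left_mono) auto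
    finally show "\<exists>m. reach {..<n} (\<lambda>_. {1..k}) f g m \<and> real m \<le> 30 ^ p * real n ^ p"
      using m(1) by auto
  qed
qed

end

section \<open>The three bounds for degenerate graphs\<close>

lemma graph_diameter_degenerate_le_power:
  assumes "pair_graph G" "degenerate d G" "d + 2 \<le> k" "2 \<le> p" "d + 1 \<le> p * (k - d - 1)"
  shows "graph_diameter (with_proj (reconfiguration_graph G k))
    \<le> ereal (30 ^ p * real (card (pverts G)) ^ p)"
proof -
  define n where "n = card (pverts G)"
  obtain e where e: "bij_betw e {..<n} (pverts G)"
    "\<And>i. i < n \<Longrightarrow> card {j. j < i \<and> (e j, e i) \<in> parcs G} \<le> d"
    using exists_degenerate_ordering[OF assms(1,2)] by (auto simp: n_def)
  \<comment> \<open>An index has at most \<open>n - 1\<close> predecessors, so \<open>d\<close> can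
    be lowered below \<open>n\<close>; the assumptions on \<open>k\<close> survive.\<close>
  define d' where "d' = min d (n - 1)"
  have "card {j. j < i \<and> (e j, e i) \<in> parcs G} \<le> d'" if "i < n" for i
  proof -
    have "card {j. j < i \<and> (e j, e i) \<in> parcs G} \<le> card {..<i}" by (intro card_mono) auto
    then show ?thesis using e(2)[OF that] that by (simp add: d'_def)
  qed
  then interpret ordered_graph G e n d'
    using assms(1) e(1) by (intro ordered_graph.intro)
  show ?thesis
  proof (cases "n = 0")
    case True
    \<comment> \<open>For \<open>n = 0\<close> there is no \<open>d' < n\<close>, but only one
      colouring exists.\<close>
    have "graph_diameter (with_proj (reconfiguration_graph G k)) \<le> ereal 0"
    proof (rule diameter_le_of_reach)
      fix f g :: "nat \<Rightarrow> nat" assume "\<And>i. i \<notin> {..<n} \<Longrightarrow> f i = g i"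
      then have "f = g" using True by auto
      then show "\<exists>m. reach {..<n} (\<lambda>_. {1..k}) f g m \<and> real m \<le> 0"
        by (auto intro!: exI[of _ 0] reach_refl)
    qed
    moreover have "ereal (30 ^ p * real (card (pverts G)) ^ p) = ereal 0"
      using True assms(4) by (simp add: n_def)
    ultimately show ?thesis by (simp only:)
  next
    case False
    have "p * (k - d - 1) \<le> p * (k - d' - 1)" by (intro mult_left_mono) (auto simp: d'_def)
    moreover have d': "d' < n" "d' \<le> d" using False by (auto simp: d'_def)
    ultimately have "d' + 1 \<le> p * (k - d' - 1)" "d' + 2 \<le> k" using assms(3,5) by linarith+
    then show ?thesis using diameter_le_power[OF d'(1)] assms(4) unfolding n_def by blast
  qed
qed

text \<open>For \<open>d = 0\<close> the third bound has exponent 1, outside the range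
  \<open>2 \<le> p\<close> of the power bound.\<close>

lemma graph_diameter_edgeless_le:
  assumes "pair_graph G" "degenerate 0 G" "2 \<le> k"
  shows "graph_diameter (with_proj (reconfiguration_graph G k)) \<le> ereal (real (card (pverts G)))"
proof -
  obtain e where e: "bij_betw e {..<card (pverts G)} (pverts G)"
    "\<And>i. i < card (pverts G) \<Longrightarrow> card {j. j < i \<and> (e j, e i) \<in> parcs G} \<le> 0"
    using exists_degenerate_ordering[OF assms(1,2)] by auto
  interpret ordered_graph G e "card (pverts G)" 0
    using assms(1) e by (intro ordered_graph.intro)
  show ?thesis using diameter_le_linear[of k] assms(3) by simp
qed

theorem theorem1:
  shows "(\<exists>C::real. C > 0 \<and>
      (\<forall>(d::nat) (k::nat) (G :: 'a pair_pre_digraph).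
         pair_graph G \<and> degenerate d G \<and> real k \<ge> 3 / 2 * (real d + 1) \<longrightarrow>
         graph_diameter (with_proj (reconfiguration_graph G k))
           \<le> ereal (C * real (card (pverts G)) ^ 2))) \<and>
    (\<forall>\<epsilon>::real. 0 < \<epsilon> \<and> \<epsilon> < 1 \<longrightarrow>
      (\<exists>C::real. C > 0 \<and>
        (\<forall>(d::nat) (k::nat) (G :: 'a pair_pre_digraph).
           pair_graph G \<and> degenerate d G \<and> real k \<ge> (1 + \<epsilon>) * (real d + 2) \<longrightarrow>
           graph_diameter (with_proj (reconfiguration_graph G k))
             \<le> ereal (C * real (card (pverts G)) ^ nat \<lceil>1 / \<epsilon>\<rceil>)))) \<and>
    (\<exists>C::real. C > 0 \<and>
      (\<forall>(d::nat) (k::nat) (G :: 'a pair_pre_digraph).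
         pair_graph G \<and> degenerate d G \<and> k \<ge> d + 2 \<longrightarrow>
         graph_diameter (with_proj (reconfiguration_graph G k))
           \<le> ereal ((C * real (card (pverts G))) ^ (d + 1))))"
proof (intro conjI allI impI)
  have "graph_diameter (with_proj (reconfiguration_graph G k))
      \<le> ereal (30 ^ 2 * real (card (pverts G)) ^ 2)"
    if "pair_graph G \<and> degenerate d G \<and> real k \<ge> 3 / 2 * (real d + 1)"
    for d k and G :: "'a pair_pre_digraph"
  proof -
    \<comment> \<open>For \<open>p = 2\<close> the condition
      \<open>d + 1 \<le> p * (k - d - 1)\<close> is \<open>3 * (d + 1) \<le> 2 * k\<close>.\<close>
    have "real (3 * d + 3) \<le> real (2 * k)" using that by auto
    then have "3 * d + 3 \<le> 2 * k" by (simp only: of_nat_le_iff)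
    then show ?thesis using that by (intro graph_diameter_degenerate_le_power[of G d]) auto
  qed
  then show "\<exists>C::real. C > 0 \<and>
      (\<forall>(d::nat) (k::nat) (G :: 'a pair_pre_digraph).
         pair_graph G \<and> degenerate d G \<and> real k \<ge> 3 / 2 * (real d + 1) \<longrightarrow>
         graph_diameter (with_proj (reconfiguration_graph G k))
           \<le> ereal (C * real (card (pverts G)) ^ 2))"
    by (intro exI[of _ "30 ^ 2"] conjI allI impI) (simp, blast)
next
  fix \<epsilon> :: real assume \<epsilon>: "0 < \<epsilon> \<and> \<epsilon> < 1"
  define p where "p = nat \<lceil>1 / \<epsilon>\<rceil>"
  have p: "1 / \<epsilon> \<le> real p" by (simp add: p_def real_nat_ceiling_ge)
  have "1 < 1 / \<epsilon>" using \<epsilon> by simp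
  \<comment> \<open>Strictness of \<open>\<epsilon> < 1\<close> brings the exponent into the range
    of the power bound.\<close>
  then have p2: "2 \<le> p" using p by linarith
  have "graph_diameter (with_proj (reconfiguration_graph G k))
      \<le> ereal (30 ^ p * real (card (pverts G)) ^ p)"
    if G: "pair_graph G \<and> degenerate d G \<and> real k \<ge> (1 + \<epsilon>) * (real d + 2)"
    for d k and G :: "'a pair_pre_digraph"
  proof -
    have k: "real k \<ge> real d + 2 + \<epsilon> * (real d + 2)" using G by (simp add: algebra_simps)
    moreover have "0 \<le> \<epsilon> * (real d + 2)" using \<epsilon> by simp
    ultimately have kd: "d + 2 \<le> k" by linarith
    then have "real (k - d - 1) = real k - real d - 1" by (simp add: of_nat_diff)
    then have "\<epsilon> * (real d + 2) \<le> real (k - d - 1)" using k by linarith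
    then have "(1 / \<epsilon>) * (\<epsilon> * (real d + 2)) \<le> real p * real (k - d - 1)"
      using p \<epsilon> by (intro mult_mono) auto
    moreover have "(1 / \<epsilon>) * (\<epsilon> * (real d + 2)) = real (d + 2)" using \<epsilon> by simp
    ultimately have "real (d + 2) \<le> real (p * (k - d - 1))" by (simp only: of_nat_mult)
    then have "d + 2 \<le> p * (k - d - 1)" by (simp only: of_nat_le_iff)
    then have "d + 1 \<le> p * (k - d - 1)" by simp
    then show ?thesis using G kd p2 by (intro graph_diameter_degenerate_le_power[of G d]) auto
  qed
  then show "\<exists>C::real. C > 0 \<and>
        (\<forall>(d::nat) (k::nat) (G :: 'a pair_pre_digraph).
           pair_graph G \<and> degenerate d G \<and> real k \<ge> (1 + \<epsilon>) * (real d + 2) \<longrightarrow>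
           graph_diameter (with_proj (reconfiguration_graph G k))
             \<le> ereal (C * real (card (pverts G)) ^ nat \<lceil>1 / \<epsilon>\<rceil>))"
    unfolding p_def[symmetric] by (intro exI[of _ "30 ^ p"] conjI allI impI) (simp, blast)
next
  have "graph_diameter (with_proj (reconfiguration_graph G k))
      \<le> ereal ((30 * real (card (pverts G))) ^ (d + 1))"
    if G: "pair_graph G \<and> degenerate d G \<and> k \<ge> d + 2" for d k and G :: "'a pair_pre_digraph"
  proof (cases "d = 0")
    case True
    then have "graph_diameter (with_proj (reconfiguration_graph G k)) \<le> ereal (real (card (pverts G)))"
      using G by (intro graph_diameter_edgeless_le) auto
    then show ?thesis using True by (elim order_trans) simp
  next
    case False
    \<comment> \<open>Since \<open>k - d - 1\<close> is at least 1, \<open>p = d + 1\<close> is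
      admissible.\<close>
    have "(d + 1) * 1 \<le> (d + 1) * (k - d - 1)" using G by (intro mult_left_mono) auto
    then have "graph_diameter (with_proj (reconfiguration_graph G k))
        \<le> ereal (30 ^ (d + 1) * real (card (pverts G)) ^ (d + 1))"
      using G False by (intro graph_diameter_degenerate_le_power[of G d]) auto
    then show ?thesis by (simp only: power_mult_distrib)
  qed
  then show "\<exists>C::real. C > 0 \<and>
      (\<forall>(d::nat) (k::nat) (G :: 'a pair_pre_digraph).
         pair_graph G \<and> degenerate d G \<and> k \<ge> d + 2 \<longrightarrow>
         graph_diameter (with_proj (reconfiguration_graph G k))
           \<le> ereal ((C * real (card (pverts G))) ^ (d + 1)))"
    by (intro exI[of _ 30] conjI allI impI) (simp, blast)
qed

end
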